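(* Let $q$ be a prime power and $n\ge 0$. (1) Let $\{\lambda_\phi\}$ be the rational canonical form data of some element of $GL(n+1,q)$. Then the number of elements $\alpha\in A(n,q)$ whose rational canonical form data (as an element of $GL(n+1,q)$) equals $\{\lambda_\phi\}$ is \[ \frac{|A(n,q)|\,\bigl(q^{\lambda'_{z-1,1}}-1\bigr)}{\prod_{\phi\neq z}\Bigl( q^{\deg(\phi)\sum_i (\lambda'_{\phi,i})^2}\prod_i \bigl(\tfrac{1}{q^{\deg(\phi)}}\bigr)_{m_i(\lambda_\phi)}\Bigr)}. \] (2) With $\{\lambda_\phi\}$ as in (1), the number of elements of $P(n,q)$ whose rational canonical form data equals $\{\lambda_\phi\}$ is \[ \sum_{a\in \mathbb{F}_q^*}\frac{|P(n,q)|\,\bigl(q^{\lambda'_{z-a,1}}-1\bigr)}{q-1}\cdot\frac{1}{\prod_{\phi\neq z}\Bigl( q^{\deg(\phi)\sum_i (\lambda'_{\phi,i})^2}\prod_i \bigl(\tfrac{1}{q^{\deg(\phi)}}\bigr)_{m_i(\lambda_\phi)}\Bigr)}. \]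
   Context: $A(n,q)$ is the group of matrices $x\in GL(n+1,q)$ with $x_{11}=1$ and $x_{j1}=0$ for $j\ge 2$; $P(n,q)$ is the group of matrices $x\in GL(n+1,q)$ with $x_{11}\ne 0$ and $x_{j1}=0$ for $j\ge2$. Rational canonical form data of $\alpha\in GL(m,q)$: for each monic irreducible polynomial $\phi\in\mathbb{F}_q[z]$, $\lambda_\phi=\lambda_\phi(\alpha)$ is the partition whose parts are the dimensions of the cyclic subspaces in a decomposition (under $\alpha$) of the $\phi$-primary component $V_\phi$ of $V=\mathbb{F}_q^m$; $\lambda_z$ is empty and $\sum_\phi|\lambda_\phi|\deg(\phi)=m$. For a partition $\lambda$: $m_i(\lambda)$ is the number of parts equal to $i$; $\lambda'$ is the conjugate partition, $\lambda'_i=m_i(\lambda)+m_{i+1}(\lambda)+\cdots$, so $\lambda'_1$ is the number of parts; $\lambda'_{\phi,i}$ denotes $(\lambda_\phi)'_i$. For $x$ and $i\ge0$, $(x)_i=(1-x)(1-x^2)\cdots(1-x^i)$ with $(x)_0=1$, so $(\frac1q)_i=\prod_{j=1}^i(1-q^{-j})$. *)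

theory Defs
  imports "Jordan_Normal_Form.Determinant" "HOL-Computational_Algebra.Polynomial"
    "HOL-Library.Multiset"
begin

text \<open>Matrices of size (n+1) x (n+1) over a finite field 'a (q = CARD('a)), indices 0..n;
  the paper's index 1 is our index 0.\<close>

definition GL :: "nat \<Rightarrow> 'a::field mat set" where
  "GL m = {x \<in> carrier_mat m m. det x \<noteq> 0}"

definition A_grp :: "nat \<Rightarrow> 'a::field mat set" where
  "A_grp n = {x \<in> GL (n+1). x $$ (0,0) = 1 \<and> (\<forall>j\<in>{1..n}. x $$ (j,0) = 0)}"

definition P_grp :: "nat \<Rightarrow> 'a::field mat set" where
  "P_grp n = {x \<in> GL (n+1). x $$ (0,0) \<noteq> 0 \<and> (\<forall>j\<in>{1..n}. x $$ (j,0) = 0)}"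

definition poly_act :: "'a::field mat \<Rightarrow> 'a poly \<Rightarrow> 'a vec \<Rightarrow> 'a vec" where
  "poly_act x p v = vec (dim_vec v) (\<lambda>r. \<Sum>i\<le>degree p. coeff p i * ((x ^\<^sub>m i) *\<^sub>v v) $ r)"

definition monic_irred :: "'a::field poly \<Rightarrow> bool" where
  "monic_irred p \<longleftrightarrow> lead_coeff p = 1 \<and> irreducible p"

text \<open>A primary cyclic decomposition of V = F^m under x: a list of triples (v, phi, k)
  with phi monic irreducible, k \<ge> 1, phi(x)^k v = 0, such that the vectors
  x^t v (t < k deg phi), over all triples, form a basis of V.  Each triple gives the
  cyclic subspace spanned by v, contained in the phi-primary component, whose dimension
  is k deg phi.\<close>
definition cyc_vectors :: "'a::field mat \<Rightarrow> ('a vec \<times> 'a poly \<times> nat) list \<Rightarrow> 'a vec list" where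
  "cyc_vectors x ds = concat (map (\<lambda>(v,p,k). map (\<lambda>t. (x ^\<^sub>m t) *\<^sub>v v) [0..<k * degree p]) ds)"

definition cyclic_decomp :: "nat \<Rightarrow> 'a::field mat \<Rightarrow> ('a vec \<times> 'a poly \<times> nat) list \<Rightarrow> bool" where
  "cyclic_decomp m x ds \<longleftrightarrow>
     (\<forall>(v,p,k) \<in> set ds. v \<in> carrier_vec m \<and> monic_irred p \<and> k \<ge> 1 \<and>
        poly_act x (p ^ k) v = 0\<^sub>v m) \<and>
     length (cyc_vectors x ds) = m \<and> det (mat_of_cols m (cyc_vectors x ds)) \<noteq> 0"

text \<open>Rational canonical form data: lambda_phi as a multiset of parts (partition),
  the parts being the sizes k of the cyclic summands (of dimension k deg phi).\<close>
definition rcf_data :: "nat \<Rightarrow> 'a::field mat \<Rightarrow> 'a poly \<Rightarrow> nat multiset" where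
  "rcf_data m x = (let ds = (SOME ds. cyclic_decomp m x ds) in
     (\<lambda>p. mset (map (\<lambda>(v,p',k). k) (filter (\<lambda>(v,p',k). p' = p) ds))))"

definition part_mult :: "nat multiset \<Rightarrow> nat \<Rightarrow> nat" where
  "part_mult lam i = count lam i"

definition part_conj :: "nat multiset \<Rightarrow> nat \<Rightarrow> nat" where
  "part_conj lam i = size (filter_mset (\<lambda>k. i \<le> k) lam)"

definition qpoch :: "real \<Rightarrow> nat \<Rightarrow> real" where
  "qpoch x i = (\<Prod>j\<in>{1..i}. 1 - x ^ j)"

text \<open>The common denominator: product over monic irreducible phi \<noteq> z; the factor for
  phi with empty lambda_phi is 1, so we range over the finitely many phi with nonempty
  lambda_phi.  Sums/products over i range over 1..|lambda_phi| (beyond that, terms vanish).\<close>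
definition rcf_denom :: "real \<Rightarrow> ('a::field poly \<Rightarrow> nat multiset) \<Rightarrow> real" where
  "rcf_denom q lam = (\<Prod>p \<in> {p. monic_irred p \<and> p \<noteq> [:0,1:] \<and> lam p \<noteq> {#}}.
      q ^ (degree p * (\<Sum>i\<in>{1..sum_mset (lam p)}. (part_conj (lam p) i)^2)) *
      (\<Prod>i\<in>{1..sum_mset (lam p)}. qpoch (1 / q ^ degree p) (part_mult (lam p) i)))"

end

theory Submission
  imports Defs "HOL-Computational_Algebra.Polynomial_Factorial"
    "HOL-Library.Cardinality"
begin

text \<open>
  A matrix makes \<open>F\<^sup>m\<close> a finite torsion module over \<open>F[z]\<close>. Generators \<open>v\<^sub>1, v\<^sub>2, \<dots>\<close> of orders
  dividing \<open>p\<^sub>i\<^bsup>k\<^sub>i\<^esup>\<close> span a direct sum of cyclic modules of full length iff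
  \<open>p\<^sub>i\<^bsup>k\<^sub>i-1\<^esup> v\<^sub>i\<close> never lies in the span of the generators chosen before. Choosing greedily with
  decreasing exponents produces the rational canonical form; counting the choices, with exponents
  decreasing within each prime, gives
  \<open>\<Prod>\<^sub>i (|ker p\<^sub>i\<^bsup>k\<^sub>i\<^esup>| - |ker p\<^sub>i\<^bsup>k\<^sub>i-1\<^esup>| q\<^bsup>deg p\<^sub>i c\<^sub>i\<^esup>)\<close>
  where \<open>c\<^sub>i\<close> counts the previous generators for \<open>p\<^sub>i\<close>, and the sizes of the kernels are given by the
  conjugate partitions. This number of generator families is the order of the centralizer, so the
  conjugacy class with data \<open>\<lambda>\<close> has \<open>|GL|\<close> divided by that many elements. Finally \<open>GL\<close> is transitive
  on nonzero vectors, so counting pairs (matrix in the class, nonzero eigenvector for \<open>a\<close>) in two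
  ways gives the number of matrices in the class with \<open>a e\<^sub>0\<close> as first column.
\<close>

section \<open>Polynomials over a field\<close>

text \<open>The test on the top power suffices by Bezout: if \<open>p^k\<close> does not divide
  \<open>f\<close>, the ideal of \<open>f\<close> and \<open>p^k\<close> contains
  \<open>p^(k-1)\<close>. The order of the exponents matters for counting the vectors that fail the
  test. Such a vector \<open>v\<close> has \<open>p^(k-1) v\<close> in the part of the old span
  killed by \<open>p\<close>, which has \<open>q^(deg p * c)\<close> elements. Each of them is
  reached as \<open>p^(k-1) w\<close> with \<open>w\<close> in the span as long as all old
  generators for \<open>p\<close> have exponent at least \<open>k\<close>; so the failing vectors
  are that many cosets of the kernel of \<open>p^(k-1)\<close>. Lists grow at the head, hence the
  decreasing choice appears as lists sorted upwards. Cardinalities stand in for dimensions, so a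
  span of the right size is automatically a direct sum. \<open>rcf_data\<close> picks a
  decomposition by \<open>SOME\<close>; since kernel sizes determine the partitions, every pick
  gives the same data. The centralizer itself is never formed: \<open>GL\<close> is matched with the
  pairs of a class member and a decomposition of it with a fixed list of orders.\<close>

definition comax :: "'a::field poly \<Rightarrow> 'a poly \<Rightarrow> bool" where
  "comax f g \<longleftrightarrow> (\<exists>s t. s * f + t * g = 1)"

lemma comax_sym: "comax f g \<Longrightarrow> comax g f"
  unfolding comax_def by (metis add.commute)

lemma comax_mult:
  assumes "comax f g" "comax f h"
  shows "comax f (g * h)"
proof -
  obtain s t u v where "s * f + t * g = 1" "u * f + v * h = 1"
    using assms unfolding comax_def by blast
  then have "(s * f + t * g) * (u * f + v * h) = 1" by simp
  then have "(s * u * f + s * v * h + t * g * u) * f + (t * v) * (g * h) = 1"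
    by (simp add: algebra_simps)
  then show ?thesis unfolding comax_def by blast
qed

lemma comax_one: "comax f 1"
  unfolding comax_def by (intro exI[of _ 0] exI[of _ 1]) simp

lemma comax_power_right: "comax f g \<Longrightarrow> comax f (g ^ k)"
  by (induction k) (auto intro: comax_one comax_mult)

lemma comax_power: "comax f g \<Longrightarrow> comax (f ^ j) (g ^ k)"
  by (meson comax_power_right comax_sym)

lemma comax_dvd_mult:
  assumes "comax f g" "f dvd g * h"
  shows "f dvd h"
proof -
  obtain s t where "s * f + t * g = 1" using assms unfolding comax_def by blast
  then have "h = (s * f + t * g) * h" by simp
  also have "\<dots> = f * (s * h) + t * (g * h)" by (simp add: algebra_simps)
  finally show ?thesis using assms(2) by (metis dvd_add dvd_mult dvd_triv_left)
qed

text \<open>Euclid's algorithm: a Bezout identity for \<open>(g, f mod g)\<close> rewrites to one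
  for \<open>(f, g)\<close>. The measure separates \<open>g = 0\<close> from the nonzero constants,
  both of degree 0.\<close>

lemma poly_ideal_principal:
  fixes f g :: "'a::field poly"
  shows "\<exists>d s t. d = s * f + t * g \<and> d dvd f \<and> d dvd g"
proof (induction "if g = 0 then 0 else Suc (degree g)" arbitrary: f g rule: less_induct)
  case less
  show ?case
  proof (cases "g = 0")
    case True
    then show ?thesis by (intro exI[of _ f] exI[of _ 1] exI[of _ 0]) auto
  next
    case False
    then have "f mod g = 0 \<or> degree (f mod g) < degree g" using degree_mod_less by blast
    then have "\<exists>d s t. d = s * g + t * (f mod g) \<and> d dvd g \<and> d dvd f mod g"
      using False by (intro less) auto
    then obtain d s t where d: "d = s * g + t * (f mod g)" "d dvd g" "d dvd f mod g" by blast
    have "d dvd f" using d(2,3) dvd_mod_imp_dvd by blast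
    moreover have "d = t * f + (s - t * (f div g)) * g"
      by (subst d(1), subst minus_div_mult_eq_mod[symmetric]) (simp add: algebra_simps)
    ultimately show ?thesis using d by blast
  qed
qed

lemma irreducible_comax:
  fixes p :: "'a::field poly"
  assumes "irreducible p" "\<not> p dvd f"
  shows "comax p f"
proof -
  obtain d s t where d: "d = s * p + t * f" "d dvd p" "d dvd f"
    using poly_ideal_principal by metis
  have "is_unit d"
    using assms d(2,3) irreducibleD' dvd_trans by blast
  then obtain e where "e * d = 1" by (metis dvdE mult.commute)
  then have "(e * s) * p + (e * t) * f = 1" using d(1) by (simp add: algebra_simps)
  then show ?thesis unfolding comax_def by blast
qed

lemma monic_irred_degree_pos: "monic_irred p \<Longrightarrow> 0 < degree p"
  unfolding monic_irred_def
  by (metis gr0I irreducible_def is_unit_iff_degree irreducible_not_unit)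

lemma monic_irred_nonzero: "monic_irred p \<Longrightarrow> p \<noteq> 0"
  using monic_irred_degree_pos by fastforce

lemma monic_irred_comax:
  assumes "monic_irred p" "monic_irred r" "p \<noteq> r"
  shows "comax p r"
proof (rule irreducible_comax)
  show "irreducible p" using assms by (simp add: monic_irred_def)
  show "\<not> p dvd r"
  proof
    assume "p dvd r"
    then obtain c where c: "r = p * c" by blast
    then have "is_unit c"
      using assms irreducibleD[of r p c] irreducible_not_unit unfolding monic_irred_def by blast
    then obtain a where a: "c = [:a:]" by (metis is_unit_polyE)
    have "lead_coeff r = lead_coeff p * a" using c a by (simp add: lead_coeff_mult)
    then have "a = 1" using assms unfolding monic_irred_def by auto
    then show False using assms(3) c a by simp
  qed
qed

lemma not_power_dvd_decompose:
  fixes p f :: "'a::field poly"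
  assumes "\<not> p ^ k dvd f"
  obtains a g where "a < k" "f = p ^ a * g" "\<not> p dvd g"
  using assms
proof (induction k arbitrary: thesis)
  case (Suc k)
  show ?case
  proof (cases "p ^ k dvd f")
    case True
    then obtain g where g: "f = p ^ k * g" by blast
    have "\<not> p dvd g" using Suc.prems(2) g by (auto simp: mult_dvd_mono mult.commute)
    then show ?thesis using Suc.prems(1) g by blast
  next
    case False
    then show ?thesis using Suc.IH Suc.prems(1) less_SucI by metis
  qed
qed simp

text \<open>With \<open>f = p ^ a * g\<close>, \<open>a < k\<close> and \<open>g\<close> coprime to
  \<open>p\<close>, the Bezout identity of \<open>p\<close> and \<open>g\<close> multiplied by
  \<open>p ^ (k - 1)\<close> is the required combination. This reduces independence to a test on a
  single power.\<close>

lemma not_power_dvd_bezout: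
  fixes p f :: "'a::field poly"
  assumes "irreducible p" "\<not> p ^ k dvd f"
  obtains s t where "s * f + t * p ^ k = p ^ (k - 1)"
proof -
  obtain a g where a: "a < k" "f = p ^ a * g" "\<not> p dvd g"
    using not_power_dvd_decompose assms(2) by metis
  obtain s t where st: "s * p + t * g = 1"
    using irreducible_comax[OF assms(1) a(3)] unfolding comax_def by blast
  have e: "p ^ (k - 1) = p ^ (k - 1 - a) * p ^ a"
    using a(1) by (simp flip: power_add)
  have e': "p ^ k = p * p ^ (k - 1)"
    using a(1) by (metis less_nat_zero_code not_gr_zero power_eq_if)
  have "(p ^ (k - 1 - a) * t) * f + s * p ^ k = p ^ (k - 1) * (s * p + t * g)"
    unfolding a(2) e' using e by (simp add: algebra_simps)
  then show ?thesis using that st by simp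
qed

section \<open>Polynomials of bounded degree, serving as remainders and later as stored
  vectors\<close>

definition polys_below :: "nat \<Rightarrow> 'a::zero poly set" where
  "polys_below n = {f. \<forall>i\<ge>n. coeff f i = 0}"

lemma polys_below_iff: "f \<in> polys_below n \<longleftrightarrow> f = 0 \<or> degree f < n"
  unfolding polys_below_def
  by (auto simp: coeff_eq_0) (metis leading_coeff_0_iff not_le)

lemma polys_below_diff: "f \<in> polys_below n \<Longrightarrow> g \<in> polys_below n \<Longrightarrow> f - g \<in> polys_below n"
  for f :: "'a::ab_group_add poly"
  unfolding polys_below_def by simp

lemma polys_below_Suc: "polys_below (Suc n) = (\<lambda>(a, f). pCons a f) ` (UNIV \<times> polys_below n)"
proof (intro subset_antisym subsetI)
  fix f :: "'a poly" assume f: "f \<in> polys_below (Suc n)"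
  obtain a g where g: "f = pCons a g" by (cases f)
  have "coeff g i = 0" if "i \<ge> n" for i
    using f that unfolding g polys_below_def by (metis (mono_tags) Suc_le_mono coeff_pCons_Suc mem_Collect_eq)
  then show "f \<in> (\<lambda>(a, f). pCons a f) ` (UNIV \<times> polys_below n)"
    unfolding g polys_below_def by auto
qed (auto simp: polys_below_def coeff_pCons split: nat.split)

lemma polys_below_card: "finite (polys_below n :: 'a::{finite,zero} poly set)"
  "card (polys_below n :: 'a::{finite,zero} poly set) = CARD('a) ^ n"
proof (induction n)
  case 0
  have "(polys_below 0 :: 'a poly set) = {0}" by (auto simp: polys_below_iff)
  then show "finite (polys_below 0 :: 'a poly set)" "card (polys_below 0 :: 'a poly set) = CARD('a) ^ 0"
    by auto
next
  case (Suc n)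
  have "inj_on (\<lambda>(a, f). pCons a f) (UNIV \<times> (polys_below n :: 'a poly set))"
    by (auto simp: inj_on_def)
  then show "finite (polys_below (Suc n) :: 'a poly set)"
    "card (polys_below (Suc n) :: 'a poly set) = CARD('a) ^ Suc n"
    using Suc unfolding polys_below_Suc by (auto simp: card_image card_cartesian_product)
qed

lemma polys_below_multiple:
  fixes g f :: "'a::field poly"
  assumes "g \<noteq> 0"
  shows "g * f \<in> polys_below (degree g + n) \<longleftrightarrow> f \<in> polys_below n"
  using assms by (cases "f = 0") (auto simp: polys_below_iff degree_mult_eq)

lemma card_multiples_below:
  fixes g :: "'a::{finite,field} poly"
  assumes "g \<noteq> 0"
  shows "card {f \<in> polys_below (degree g + n). g dvd f} = CARD('a) ^ n"
proof -
  have "{f \<in> polys_below (degree g + n). g dvd f} = (*) g ` polys_below n"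
    using polys_below_multiple[OF assms] by (auto elim!: dvdE)
  moreover have "inj_on ((*) g) (polys_below n)" using assms by (auto simp: inj_on_def)
  ultimately show ?thesis by (simp add: card_image polys_below_card)
qed

lemma mod_in_polys_below:
  fixes g :: "'a::field poly"
  assumes "g \<noteq> 0"
  shows "f mod g \<in> polys_below (degree g)"
  using degree_mod_less[OF assms] by (auto simp: polys_below_iff)

lemma power_dvd_power_mult_iff:
  fixes p f :: "'a::field poly"
  assumes "monic_irred p"
  shows "p ^ k dvd p ^ j * f \<longleftrightarrow> p ^ (k - min j k) dvd f"
proof (cases "j \<le> k")
  case True
  have "p ^ k = p ^ j * p ^ (k - j)" using True by (simp flip: power_add)
  moreover have "p ^ j \<noteq> 0" using monic_irred_nonzero[OF assms] by simp
  ultimately show ?thesis using True by (metis dvd_times_left_cancel_iff min_absorb1)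
next
  case False
  then show ?thesis using le_imp_power_dvd[of k j p] by (simp add: dvd_mult2)
qed

lemma monic_irred_degree_power: "degree (p ^ k) = k * degree p" if "monic_irred p" for p :: "'a::field poly"
  by (simp add: degree_power_eq monic_irred_nonzero that)

text \<open>This is the kernel of \<open>P ^ j\<close> on the cyclic module of order
  \<open>p ^ k\<close>, with residues as elements. For \<open>p = P\<close> it consists of the
  multiples of \<open>p ^ (k - min j k)\<close>; for \<open>p \<noteq> P\<close> the power
  \<open>P ^ j\<close> is invertible modulo \<open>p ^ k\<close>, which leaves only 0.\<close>

lemma card_killed_coeffs:
  fixes p P :: "'a::{finite,field} poly"
  assumes "monic_irred p" "monic_irred P"
  shows "card {f \<in> polys_below (k * degree p). p ^ k dvd P ^ j * f}
    = CARD('a) ^ (if p = P then degree P * min j k else 0)"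
proof (cases "p = P")
  case True
  have "k * degree p = degree (p ^ (k - min j k)) + degree p * min j k"
    unfolding monic_irred_degree_power[OF assms(1)] by (simp add: algebra_simps flip: add_mult_distrib)
  then show ?thesis
    using card_multiples_below[of "p ^ (k - min j k)" "degree p * min j k"]
      monic_irred_nonzero[OF assms(1)] True
    by (simp add: power_dvd_power_mult_iff[OF assms(2)])
next
  case False
  then have "comax (p ^ k) (P ^ j)"
    using assms comax_power monic_irred_comax by blast
  then have "p ^ k dvd P ^ j * f \<longleftrightarrow> p ^ k dvd f" for f
    by (meson comax_dvd_mult dvd_mult)
  then show ?thesis
    using card_multiples_below[of "p ^ k" 0] monic_irred_nonzero[OF assms(1)] False
    by (simp add: monic_irred_degree_power[OF assms(1)])
qed

text \<open>A divisor of least positive degree cannot factor further; dividing by its leading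
  coefficient makes it monic.\<close>

lemma monic_irred_divisor_exists:
  fixes f :: "'a::field poly"
  assumes "0 < degree f"
  obtains p where "monic_irred p" "p dvd f"
proof -
  define Q where "Q = (\<lambda>g. g dvd f \<and> 0 < degree g)"
  have "Q f" using assms by (simp add: Q_def)
  then obtain g where g: "Q g" "\<And>h. Q h \<Longrightarrow> degree g \<le> degree h"
    using ex_has_least_nat[of Q f degree] by blast
  define p where "p = smult (inverse (lead_coeff g)) g"
  have g0: "lead_coeff g \<noteq> 0" using g(1) unfolding Q_def by force
  have pdvd: "p dvd f" using g(1) g0 unfolding p_def Q_def by (simp add: smult_dvd)
  have degp: "degree p = degree g" using g0 by (simp add: p_def)
  have p0: "p \<noteq> 0" using degp g(1) unfolding Q_def by fastforce
  have "irreducible p"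
  proof (rule irreducibleI)
    show "\<not> is_unit p" using degp g(1) p0 unfolding Q_def by (simp add: is_unit_iff_degree)
    fix a b assume ab: "p = a * b"
    then have ab0: "a \<noteq> 0" "b \<noteq> 0" using p0 by auto
    have "degree a = 0 \<or> degree b = 0"
    proof (rule ccontr)
      assume *: "\<not> ?thesis"
      have "a dvd f" using pdvd dvd_mult_left[of a b f] ab by simp
      then have "Q a" using * by (simp add: Q_def)
      then have "degree p \<le> degree a" using g(2) degp by simp
      then show False using * ab ab0 by (simp add: degree_mult_eq)
    qed
    then show "is_unit a \<or> is_unit b" using ab0 by (auto simp: is_unit_iff_degree)
  qed (rule p0)
  moreover have "lead_coeff p = 1" using g0 by (simp add: p_def)
  ultimately show ?thesis using that pdvd unfolding monic_irred_def by blast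
qed

section \<open>Finite torsion modules over the polynomial ring\<close>

definition wt :: "('a::field poly \<times> nat) list \<Rightarrow> nat" where
  "wt L = (\<Sum>(p, k)\<leftarrow>L. k * degree p)"

text \<open>The exponent of a kernel size: on a direct sum of cyclic modules with orders listed in
  \<open>L\<close>, the kernel of \<open>P ^ j\<close> has
  \<open>q ^ (degree P * minsum P j L)\<close> elements. For \<open>j = 1\<close> and positive
  exponents it counts the entries belonging to \<open>P\<close>.\<close>

definition minsum :: "'a::field poly \<Rightarrow> nat \<Rightarrow> ('a poly \<times> nat) list \<Rightarrow> nat" where
  "minsum P j L = (\<Sum>(p, k)\<leftarrow>L. if p = P then min j k else 0)"

lemma wt_Cons [simp]: "wt ((p, k) # L) = k * degree p + wt L" and wt_Nil [simp]: "wt [] = 0"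
  by (simp_all add: wt_def)

lemma minsum_Cons [simp]: "minsum P j ((p, k) # L) = (if p = P then min j k else 0) + minsum P j L"
  and minsum_Nil [simp]: "minsum P j [] = 0"
  by (simp_all add: minsum_def)

text \<open>The head is the generator chosen last. \<open>K p j\<close> stands for the size of the
  kernel of \<open>p ^ j\<close> in the whole module; in a sorted list the subtracted product is the
  number of vectors killed by \<open>p ^ k\<close> that fail the independence test against the
  tail.\<close>

fun family_count ::
  "('a::{finite,field} poly \<Rightarrow> nat \<Rightarrow> nat) \<Rightarrow> ('a poly \<times> nat) list \<Rightarrow> real" where
  "family_count K [] = 1"
| "family_count K ((p, k) # L) =
    (real (K p k) - real (K p (k - 1)) * real CARD('a) ^ (degree p * minsum p 1 L)) * family_count K L"

text \<open>The scalars are polynomials, so \<open>span\<close> and \<open>subspace\<close> mean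
  generated submodule and submodule.\<close>

locale poly_module = Modules.module scale
  for scale :: "'a::{finite,field} poly \<Rightarrow> 'v::ab_group_add \<Rightarrow> 'v" (infixr \<open>*s\<close> 75)
begin

definition gen :: "('v \<times> 'a poly \<times> nat) list \<Rightarrow> 'v set" where
  "gen ds = span (fst ` set ds)"

definition killed :: "('v \<times> 'a poly \<times> nat) list \<Rightarrow> bool" where
  "killed ds \<longleftrightarrow> (\<forall>(v, p, k)\<in>set ds. monic_irred p \<and> 1 \<le> k \<and> p ^ k *s v = 0)"

text \<open>Each generator is tested only against the tail, the part of the family chosen before it.
  For families that are \<open>killed\<close> the outcome still does not depend on the order, since
  it amounts to the span having full size.\<close>

fun indep :: "('v \<times> 'a poly \<times> nat) list \<Rightarrow> bool" where
  "indep [] \<longleftrightarrow> True"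
| "indep ((v, p, k) # ds) \<longleftrightarrow>
    monic_irred p \<and> 1 \<le> k \<and> p ^ k *s v = 0 \<and> p ^ (k - 1) *s v \<notin> gen ds \<and> indep ds"

lemma killed_Cons [simp]:
  "killed ((v, p, k) # ds) \<longleftrightarrow> monic_irred p \<and> 1 \<le> k \<and> p ^ k *s v = 0 \<and> killed ds"
  and killed_Nil [simp]: "killed []"
  by (auto simp: killed_def)

lemma indep_killed: "indep ds \<Longrightarrow> killed ds"
  by (induction ds rule: indep.induct) auto

lemma subspace_gen: "subspace (gen ds)"
  unfolding gen_def by simp

lemma gen_Nil [simp]: "gen [] = {0}"
  by (simp add: gen_def)

lemma gen_subset: "subspace V \<Longrightarrow> fst ` set ds \<subseteq> V \<Longrightarrow> gen ds \<subseteq> V"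
  unfolding gen_def by (rule span_minimal)

lemma gen_Cons: "gen ((v, p, k) # ds) = (\<lambda>(f, w). f *s v + w) ` (UNIV \<times> gen ds)"
proof -
  have "gen ((v, p, k) # ds) = {x. \<exists>f. x - f *s v \<in> gen ds}"
    by (simp add: gen_def span_insert)
  also have "\<dots> = (\<lambda>(f, w). f *s v + w) ` (UNIV \<times> gen ds)"
  proof (intro subset_antisym subsetI)
    fix x assume "x \<in> {x. \<exists>f. x - f *s v \<in> gen ds}"
    then obtain f where "x - f *s v \<in> gen ds" by blast
    then show "x \<in> (\<lambda>(f, w). f *s v + w) ` (UNIV \<times> gen ds)"
      by (intro image_eqI[of _ _ "(f, x - f *s v)"]) auto
  next
    fix x assume "x \<in> (\<lambda>(f, w). f *s v + w) ` (UNIV \<times> gen ds)"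
    then obtain f w where "w \<in> gen ds" "x = f *s v + w" by auto
    then show "x \<in> {x. \<exists>f. x - f *s v \<in> gen ds}" by (auto intro!: exI[of _ f])
  qed
  finally show ?thesis .
qed

lemma gen_Cons_mono: "gen ds \<subseteq> gen (d # ds)"
  unfolding gen_def by (rule span_mono) auto

lemma scale_mod: "g *s v \<in> gen ds \<Longrightarrow> f *s v - (f mod g) *s v \<in> gen ds"
proof -
  assume g: "g *s v \<in> gen ds"
  have "f *s v - (f mod g) *s v = (f - f mod g) *s v" by (simp add: scale_left_diff_distrib)
  also have "\<dots> = (f div g) *s g *s v" by (simp add: minus_mod_eq_div_mult)
  finally show ?thesis using subspace_scale[OF subspace_gen g, of "f div g"] by simp
qed

lemma gen_Cons_below:
  assumes "g \<noteq> 0" "g *s v \<in> gen ds"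
  shows "gen ((v, p, k) # ds) = (\<lambda>(f, w). f *s v + w) ` (polys_below (degree g) \<times> gen ds)"
proof -
  have "\<exists>f'\<in>polys_below (degree g). \<exists>w'\<in>gen ds. f *s v + w = f' *s v + w'" if "w \<in> gen ds" for f w
  proof (intro bexI)
    show "f mod g \<in> polys_below (degree g)" using assms(1) by (rule mod_in_polys_below)
    show "f *s v - (f mod g) *s v + w \<in> gen ds"
      using scale_mod[OF assms(2)] that by (intro subspace_add[OF subspace_gen])
  qed simp
  then show ?thesis unfolding gen_Cons by (auto simp: image_iff)
qed

text \<open>Otherwise \<open>p ^ (k - 1)\<close> would be a combination of \<open>f\<close> and
  \<open>p ^ k\<close>, and \<open>p ^ (k - 1) *s v\<close> would lie in the span. So the
  annihilator of \<open>v\<close> modulo the span is generated by \<open>p ^ k\<close>.\<close>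

lemma indep_dvd:
  assumes "indep ((v, p, k) # ds)" "f *s v \<in> gen ds"
  shows "p ^ k dvd f"
proof (rule ccontr)
  assume "\<not> p ^ k dvd f"
  moreover have "irreducible p" using assms(1) by (simp add: monic_irred_def)
  ultimately obtain s t where st: "s * f + t * p ^ k = p ^ (k - 1)"
    using not_power_dvd_bezout by metis
  have "p ^ (k - 1) *s v = (s * f + t * p ^ k) *s v" by (simp only: st)
  also have "\<dots> = s *s (f *s v) + t *s (p ^ k *s v)" by (simp add: scale_left_distrib)
  also have "\<dots> = s *s (f *s v)" using assms(1) by (simp del: scale_scale)
  finally show False using assms subspace_scale[OF subspace_gen, of "f *s v" ds s] by simp
qed

lemma dvd_annihilates: "g dvd f \<Longrightarrow> g *s v = 0 \<Longrightarrow> f *s v = 0"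
  by (metis dvd_def mult.commute scale_scale scale_zero_right)

lemma indep_inj:
  assumes "indep ((v, p, k) # ds)"
  shows "inj_on (\<lambda>(f, w). f *s v + w) (polys_below (k * degree p) \<times> gen ds)"
proof (rule inj_onI, clarify)
  fix f w f' w'
  assume f: "f \<in> polys_below (k * degree p)" "f' \<in> polys_below (k * degree p)"
    and w: "w \<in> gen ds" "w' \<in> gen ds" and eq: "f *s v + w = f' *s v + w'"
  have p: "monic_irred p" using assms by simp
  have "(f - f') *s v = w' - w" using eq by (simp add: algebra_simps)
  then have "p ^ k dvd f - f'" using indep_dvd[OF assms] subspace_diff[OF subspace_gen] w by metis
  moreover have "f - f' \<in> polys_below (degree (p ^ k))"
    using polys_below_diff f by (simp add: monic_irred_degree_power[OF p])
  ultimately have "f - f' = 0" by (metis dvd_imp_degree_le leD polys_below_iff)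
  then show "f = f' \<and> w = w'" using eq by simp
qed

text \<open>Coefficients of the head generator can be reduced modulo \<open>p ^ k\<close>, and by
  \<open>indep_inj\<close> the reduced representation is unique, so each generator multiplies the
  size by \<open>q ^ (k * degree p)\<close>.\<close>

lemma indep_card_gen:
  assumes "indep ds"
  shows "finite (gen ds)" "card (gen ds) = CARD('a) ^ wt (map snd ds)"
proof -
  have "finite (gen ds) \<and> card (gen ds) = CARD('a) ^ wt (map snd ds)"
    using assms
  proof (induction ds rule: indep.induct)
    case (2 v p k ds)
    let ?D = "(polys_below (k * degree p) :: 'a poly set) \<times> gen ds"
    have p: "monic_irred p" using 2 by simp
    have "gen ((v, p, k) # ds) = (\<lambda>(f, w). f *s v + w) ` ?D"
      using 2 gen_Cons_below[of "p ^ k" v ds p k] monic_irred_nonzero[OF p] subspace_0[OF subspace_gen]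
      by (simp add: monic_irred_degree_power[OF p])
    moreover have "card ((\<lambda>(f, w). f *s v + w) ` ?D) = card ?D"
      using indep_inj[OF 2(2)] by (rule card_image)
    moreover have "finite ?D" using 2 polys_below_card by auto
    ultimately show ?case
      using 2 by (simp add: card_cartesian_product polys_below_card power_add)
  qed simp
  then show "finite (gen ds)" "card (gen ds) = CARD('a) ^ wt (map snd ds)" by auto
qed

lemma two_le_card: "2 \<le> CARD('a)"
  using card_mono[of "UNIV :: 'a set" "{0, 1}"] by simp

text \<open>A converse by size alone: if some \<open>p ^ (k - 1) *s v\<close> fell into the span of
  the tail, coefficients below degree \<open>(k - 1) * degree p\<close> would suffice and the span
  would be too small.\<close>

lemma killed_card_gen:
  assumes "killed ds"
  shows "finite (gen ds)" "card (gen ds) \<le> CARD('a) ^ wt (map snd ds)"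
    "card (gen ds) = CARD('a) ^ wt (map snd ds) \<Longrightarrow> indep ds"
proof -
  have "finite (gen ds) \<and> card (gen ds) \<le> CARD('a) ^ wt (map snd ds) \<and>
      (card (gen ds) = CARD('a) ^ wt (map snd ds) \<longrightarrow> indep ds)"
    using assms
  proof (induction ds rule: indep.induct)
    case (2 v p k ds)
    have p: "monic_irred p" and pk: "p ^ k *s v = 0" and k: "1 \<le> k" using 2 by auto
    have IH: "finite (gen ds)" "card (gen ds) \<le> CARD('a) ^ wt (map snd ds)"
      "card (gen ds) = CARD('a) ^ wt (map snd ds) \<Longrightarrow> indep ds" using 2 by auto
    \<comment> \<open>Used with \<open>j = k\<close> for the general upper bound and with
      \<open>j = k - 1\<close> to refute a failed test.\<close>
    have bound: "finite (gen ((v, p, k) # ds)) \<and>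
        card (gen ((v, p, k) # ds)) \<le> CARD('a) ^ (j * degree p) * card (gen ds)"
      if "p ^ j *s v \<in> gen ds" for j
    proof -
      let ?D = "(polys_below (j * degree p) :: 'a poly set) \<times> gen ds"
      have "gen ((v, p, k) # ds) = (\<lambda>(f, w). f *s v + w) ` ?D"
        using gen_Cons_below[of "p ^ j" v ds p k] monic_irred_nonzero[OF p] that
        by (simp add: monic_irred_degree_power[OF p])
      moreover have "finite ?D" using IH polys_below_card by auto
      ultimately show ?thesis
        using card_image_le[of ?D "\<lambda>(f, w). f *s v + w"]
        by (simp add: card_cartesian_product polys_below_card)
    qed
    note b = bound[of k, unfolded pk, OF subspace_0[OF subspace_gen]]
    have le: "CARD('a) ^ (k * degree p) * card (gen ds)
        \<le> CARD('a) ^ (k * degree p) * CARD('a) ^ wt (map snd ds)"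
      using IH(2) by simp
    have "indep ((v, p, k) # ds)"
      if eq: "card (gen ((v, p, k) # ds)) = CARD('a) ^ (k * degree p) * CARD('a) ^ wt (map snd ds)"
    proof -
      have "CARD('a) ^ (k * degree p) * card (gen ds)
          = CARD('a) ^ (k * degree p) * CARD('a) ^ wt (map snd ds)"
        using le b eq by simp
      then have c: "card (gen ds) = CARD('a) ^ wt (map snd ds)" by simp
      have "p ^ (k - 1) *s v \<notin> gen ds"
      proof
        assume "p ^ (k - 1) *s v \<in> gen ds"
        from bound[OF this]
        have "CARD('a) ^ (k * degree p) * card (gen ds) \<le> CARD('a) ^ ((k - 1) * degree p) * card (gen ds)"
          using eq c by simp
        then have "CARD('a) ^ (k * degree p) \<le> CARD('a) ^ ((k - 1) * degree p)"
          using c by simp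
        then have "k * degree p \<le> (k - 1) * degree p"
          using two_le_card by (simp add: power_increasing_iff)
        then show False using k monic_irred_degree_pos[OF p] by simp
      qed
      then show ?thesis using IH(3)[OF c] p pk k by simp
    qed
    moreover have "card (gen ((v, p, k) # ds)) \<le> CARD('a) ^ (k * degree p) * CARD('a) ^ wt (map snd ds)"
      using b le by (meson order_trans)
    ultimately show ?case using b by (simp add: power_add)
  qed simp
  then show "finite (gen ds)" "card (gen ds) \<le> CARD('a) ^ wt (map snd ds)"
    "card (gen ds) = CARD('a) ^ wt (map snd ds) \<Longrightarrow> indep ds" by auto
qed

text \<open>The equation puts \<open>(g * f) *s v\<close> into the span of the tail, and then
  \<open>indep_dvd\<close> makes it zero.\<close>

lemma indep_annihilates_split:
  assumes "indep ((v, p, k) # ds)" "w \<in> gen ds" "g *s (f *s v + w) = 0"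
  shows "p ^ k dvd g * f" "(g * f) *s v = 0" "g *s w = 0"
proof -
  have "(g * f) *s v = - (g *s w)"
    using assms(3) by (simp add: scale_right_distrib eq_neg_iff_add_eq_0)
  moreover have "- (g *s w) \<in> gen ds"
    using assms(2) by (intro subspace_neg subspace_scale subspace_gen)
  ultimately show d: "p ^ k dvd g * f" using indep_dvd[OF assms(1)] by simp
  show z: "(g * f) *s v = 0" using dvd_annihilates[OF d] assms(1) by simp
  show "g *s w = 0" using assms(3) z by (simp add: scale_right_distrib)
qed

text \<open>A sum is killed by \<open>P ^ j\<close> iff its components are, so the kernel is a
  product over the cyclic summands, with factors given by \<open>card_killed_coeffs\<close>.\<close>

lemma indep_card_kernel:
  assumes "indep ds" "monic_irred P"
  shows "card {u \<in> gen ds. P ^ j *s u = 0} = CARD('a) ^ (degree P * minsum P j (map snd ds))"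
  using assms(1)
proof (induction ds rule: indep.induct)
  case 1
  have "{u \<in> gen []. P ^ j *s u = 0} = {0}" by auto
  then show ?case by simp
next
  case (2 v p k ds)
  have p: "monic_irred p" and pk: "p ^ k *s v = 0" using 2 by auto
  let ?F = "{f \<in> polys_below (k * degree p). p ^ k dvd P ^ j * f}"
  let ?K = "{u \<in> gen ds. P ^ j *s u = 0}"
  have "{u \<in> gen ((v, p, k) # ds). P ^ j *s u = 0} = (\<lambda>(f, w). f *s v + w) ` (?F \<times> ?K)"
  proof (intro subset_antisym subsetI)
    fix u assume u: "u \<in> {u \<in> gen ((v, p, k) # ds). P ^ j *s u = 0}"
    then obtain f w where fw: "f \<in> polys_below (k * degree p)" "w \<in> gen ds" "u = f *s v + w"
      using gen_Cons_below[of "p ^ k" v ds p k] monic_irred_nonzero[OF p] pk subspace_0[OF subspace_gen]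
      by (auto simp: monic_irred_degree_power[OF p])
    have "P ^ j *s (f *s v + w) = 0" using u fw by simp
    from indep_annihilates_split[OF 2(2) fw(2) this]
    show "u \<in> (\<lambda>(f, w). f *s v + w) ` (?F \<times> ?K)" using fw by (auto simp: image_iff)
  next
    fix u assume "u \<in> (\<lambda>(f, w). f *s v + w) ` (?F \<times> ?K)"
    then obtain f w where fw: "f \<in> ?F" "w \<in> ?K" "u = f *s v + w" by auto
    have "(P ^ j * f) *s v = 0" using fw(1) pk dvd_annihilates by blast
    then show "u \<in> {u \<in> gen ((v, p, k) # ds). P ^ j *s u = 0}"
      using fw(2,3) by (auto simp: gen_Cons scale_right_distrib)
  qed
  moreover have "inj_on (\<lambda>(f, w). f *s v + w) (?F \<times> ?K)"
    using indep_inj[OF 2(2)] by (rule inj_on_subset) auto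
  ultimately have "card {u \<in> gen ((v, p, k) # ds). P ^ j *s u = 0} = card ?F * card ?K"
    by (simp add: card_image card_cartesian_product)
  then show ?case
    using 2 by (simp add: card_killed_coeffs[OF p assms(2)] add_mult_distrib2 power_add)
qed

text \<open>In a summand of order \<open>P ^ k\<close> the vectors killed by \<open>P\<close> are
  multiples of \<open>P ^ (k - 1) *s v\<close>, hence of the form \<open>P ^ (j - 1) *s w\<close>
  because \<open>j \<le> k\<close>; summands for other primes contribute only 0. A summand for
  \<open>P\<close> with a smaller exponent would break this.\<close>

lemma socle_lift:
  assumes "indep ds" "monic_irred P" "1 \<le> j" "\<And>v k. (v, P, k) \<in> set ds \<Longrightarrow> j \<le> k"
    "u \<in> gen ds" "P *s u = 0"
  shows "\<exists>w\<in>gen ds. P ^ (j - 1) *s w = u"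
  using assms(1,4,5,6)
proof (induction ds arbitrary: u rule: indep.induct)
  case 1
  then show ?case by auto
next
  case (2 v p k ds)
  have p: "monic_irred p" using 2 by simp
  obtain f w where fw: "w \<in> gen ds" "u = f *s v + w" using 2(4) by (auto simp: gen_Cons)
  note split = indep_annihilates_split[OF 2(2) fw(1) 2(5)[unfolded fw(2)]]
  have "\<exists>w'\<in>gen ds. P ^ (j - 1) *s w' = w"
    using 2 fw(1) split(3) by (intro 2(1)) auto
  then obtain w' where w': "w' \<in> gen ds" "P ^ (j - 1) *s w' = w" by blast
  have "\<exists>f'. P ^ (j - 1) *s f' *s v = f *s v"
  proof (cases "p = P")
    case True
    then have jk: "j \<le> k" using 2(3) by auto
    have "P ^ (k - 1) dvd f"
      using split(1) assms(3) jk power_dvd_power_mult_iff[OF p, of k 1 f] True by simp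
    moreover have "P ^ (j - 1) dvd P ^ (k - 1)" using jk by (simp add: le_imp_power_dvd)
    ultimately obtain f' where "f = P ^ (j - 1) * f'" by (meson dvdE dvd_trans)
    then show ?thesis by (intro exI[of _ f']) simp
  next
    case False
    then have "comax (p ^ k) (P ^ 1)"
      using p assms(2) by (intro comax_power monic_irred_comax)
    then have "p ^ k dvd f" using comax_dvd_mult split(1) by auto
    then have "f *s v = 0" using dvd_annihilates 2(2) by auto
    then show ?thesis by (intro exI[of _ 0]) simp
  qed
  then obtain f' where "P ^ (j - 1) *s f' *s v = f *s v" by blast
  then have "P ^ (j - 1) *s (f' *s v + w') = u" using w' fw by (simp add: scale_right_distrib)
  then show ?case using w'(1) unfolding gen_Cons by force
qed

section \<open>Existence of an independent generating family\<close>

lemma indep_length_le: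
  assumes "indep ds"
  shows "length ds \<le> wt (map snd ds)"
  using assms
proof (induction ds rule: indep.induct)
  case (2 v p k ds)
  then have "1 \<le> k * degree p" using monic_irred_degree_pos[of p] by (simp add: Suc_le_eq)
  moreover have "length ds \<le> wt (map snd ds)" using 2 by simp
  ultimately have "1 + length ds \<le> k * degree p + wt (map snd ds)" by (rule add_mono)
  then show ?case by simp
qed simp

text \<open>Pigeonhole on the powers gives \<open>P ^ s *s v = P ^ t *s v\<close> with
  \<open>s < t\<close>; repeating the step pushes the exponent past \<open>i\<close>, so
  \<open>P ^ s *s v\<close> is already 0. Thus the empty family is saturated above level
  \<open>card V\<close>, where the downward induction starts.\<close>

lemma nilpotent_bound:
  assumes V: "subspace V" "finite V" and v: "v \<in> V" "P ^ i *s v = 0" and i: "card V < i"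
  shows "P ^ (i - 1) *s v = 0"
proof -
  have "\<not> inj_on (\<lambda>t. P ^ t *s v) {..card V}"
  proof
    assume "inj_on (\<lambda>t. P ^ t *s v) {..card V}"
    then have "card {..card V} \<le> card V"
      using v subspace_scale[OF V(1)] by (intro card_inj_on_le[of _ _ V] V(2)) auto
    then show False by simp
  qed
  then obtain s t where st: "s \<le> card V" "s < t" "P ^ s *s v = P ^ t *s v"
    unfolding inj_on_def by (metis atMost_iff linorder_neqE_nat)
  have loop: "P ^ s *s v = P ^ (s + n * (t - s)) *s v" for n
  proof (induction n)
    case (Suc n)
    have "P ^ (s + Suc n * (t - s)) = P ^ (n * (t - s)) * P ^ t"
      using st(2) by (simp add: add.commute flip: power_add)
    then have "P ^ (s + Suc n * (t - s)) *s v = P ^ (n * (t - s)) *s P ^ t *s v" by simp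
    also have "\<dots> = P ^ (n * (t - s)) *s P ^ s *s v" using st(3) by (simp del: scale_scale)
    also have "\<dots> = P ^ (s + n * (t - s)) *s v" by (simp add: power_add mult.commute)
    finally show ?case using Suc by simp
  qed simp
  have "i \<le> s + i * (t - s)" using st(2) by (simp add: Suc_le_eq trans_le_add2)
  then have "P ^ s *s v = 0" using loop[of i] v(2) dvd_annihilates le_imp_power_dvd by metis
  moreover have "P ^ s dvd P ^ (i - 1)" using st(1) i by (intro le_imp_power_dvd) auto
  ultimately show ?thesis using dvd_annihilates by blast
qed

lemma torsion_of_finite:
  assumes "subspace V" "finite V" "v \<in> V"
  obtains f where "f \<noteq> 0" "f *s v = 0"
proof -
  have "\<not> inj (\<lambda>n. monom 1 n *s v)"
  proof
    assume "inj (\<lambda>n. monom 1 n *s v)"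
    then have "infinite (range (\<lambda>n. monom 1 n *s v))" using finite_imageD infinite_UNIV_nat by blast
    moreover have "range (\<lambda>n. monom 1 n *s v) \<subseteq> V" using assms subspace_scale by blast
    ultimately show False using assms(2) finite_subset by blast
  qed
  then obtain i j :: nat where ij: "i \<noteq> j" "monom 1 i *s v = monom 1 j *s v"
    unfolding inj_def by blast
  have "monom 1 i - monom (1::'a) j \<noteq> 0" using ij(1) by (simp add: monom_eq_iff')
  moreover have "(monom 1 i - monom 1 j) *s v = 0" using ij(2) by (simp add: scale_left_diff_distrib)
  ultimately show ?thesis using that by blast
qed

text \<open>Induction on the degree of an annihilating polynomial \<open>f = p ^ a * g\<close>: a
  Bezout identity for \<open>p ^ a\<close> and \<open>g\<close> splits \<open>v\<close> into a part
  killed by \<open>g\<close>, of smaller degree, and a part killed by \<open>p ^ a\<close>.\<close>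

lemma primary_parts_generate:
  assumes V: "subspace V" "finite V" and N: "subspace N"
    and prim: "\<And>P i v. monic_irred P \<Longrightarrow> v \<in> V \<Longrightarrow> P ^ i *s v = 0 \<Longrightarrow> v \<in> N"
  shows "V \<subseteq> N"
proof
  fix v assume v: "v \<in> V"
  then obtain f where "f \<noteq> 0" "f *s v = 0" using torsion_of_finite V by blast
  then show "v \<in> N" using v
  proof (induction "degree f" arbitrary: f v rule: less_induct)
    case less
    show ?case
    proof (cases "degree f = 0")
      case True
      then obtain c where c: "c * f = 1"
        using less.prems(1) by (metis is_unit_iff_degree dvdE mult.commute)
      have "v = c *s f *s v" by (simp add: c)
      then show ?thesis using less.prems(2) subspace_0[OF N] by (simp del: scale_scale)
    next
      case False
      then obtain p where p: "monic_irred p" "p dvd f" using monic_irred_divisor_exists by blast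
      \<comment> \<open>The exponent is merely large enough: such a power of \<open>p\<close> has
        degree above that of \<open>f\<close>.\<close>
      have "\<not> p ^ Suc (degree f) dvd f"
      proof
        assume "p ^ Suc (degree f) dvd f"
        then have "Suc (degree f) * degree p \<le> degree f"
          using dvd_imp_degree_le less.prems(1) monic_irred_degree_power[OF p(1)] by metis
        then show False using monic_irred_degree_pos[OF p(1)] by (cases "degree p") auto
      qed
      then obtain a g where ag: "f = p ^ a * g" "\<not> p dvd g" using not_power_dvd_decompose by metis
      have a: "a \<noteq> 0" using ag p(2) by (cases a) auto
      have "comax (p ^ a) (g ^ 1)"
        using p(1) ag(2) by (intro comax_power irreducible_comax) (auto simp: monic_irred_def)
      then obtain s t where st: "s * p ^ a + t * g = 1" unfolding comax_def by auto
      have "g \<noteq> 0" using ag less.prems(1) by auto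
      then have "degree g < degree f"
        using a monic_irred_degree_pos[OF p(1)] monic_irred_nonzero[OF p(1)]
        by (simp add: ag(1) degree_mult_eq degree_power_eq)
      then have "p ^ a *s v \<in> N"
        using \<open>g \<noteq> 0\<close> less.prems subspace_scale[OF V(1)]
        by (intro less.hyps[of g]) (auto simp: ag(1) mult.commute)
      moreover have "g *s v \<in> N"
        using less.prems subspace_scale[OF V(1)] by (intro prim[OF p(1), of _ a]) (auto simp: ag(1))
      moreover have "v = s *s p ^ a *s v + t *s g *s v"
        by (simp flip: scale_left_distrib add: st)
      ultimately show ?thesis using subspace_add[OF N] subspace_scale[OF N] by metis
    qed
  qed
qed

text \<open>Greedy construction, from the largest exponent downwards: a family is saturated at level j
  when, modulo its span, every primary vector of order at least j has smaller order.\<close>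

lemma greedy_family:
  assumes V: "subspace V" "finite V" and j: "1 \<le> j" "j \<le> Suc (card V)"
  shows "\<exists>ds. indep ds \<and> fst ` set ds \<subseteq> V \<and> (\<forall>(v, p, k)\<in>set ds. j \<le> k) \<and>
    (\<forall>P i v. monic_irred P \<longrightarrow> j \<le> i \<longrightarrow> v \<in> V \<longrightarrow> P ^ i *s v = 0 \<longrightarrow>
      (\<exists>w\<in>gen ds. P ^ (i - 1) *s (v - w) = 0))"
  using j(2,1)
proof (induction j rule: inc_induct)
  case base
  show ?case using nilpotent_bound[OF V] by (intro exI[of _ "[]"]) auto
next
  case (step j)
  then obtain ds where ds: "indep ds" "fst ` set ds \<subseteq> V" "\<forall>(v, p, k)\<in>set ds. Suc j \<le> k"
    and sat: "\<And>P i v. monic_irred P \<Longrightarrow> Suc j \<le> i \<Longrightarrow> v \<in> V \<Longrightarrow> P ^ i *s v = 0 \<Longrightarrow>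
      \<exists>w\<in>gen ds. P ^ (i - 1) *s (v - w) = 0"
    by fastforce
  \<comment> \<open>Families of exponents at least \<open>j\<close> whose span contains that of
    \<open>ds\<close>; one of greatest length is taken. Lengths are bounded because a family of
    length \<open>l\<close> spans at least \<open>2 ^ l\<close> vectors.\<close>
  define X where "X = (\<lambda>es. indep es \<and> fst ` set es \<subseteq> V \<and> (\<forall>(v, p, k)\<in>set es. j \<le> k) \<and> gen ds \<subseteq> gen es)"
  have "X ds" using ds by (auto simp: X_def)
  moreover have "\<forall>es. X es \<longrightarrow> length es < card V"
  proof (intro allI impI)
    fix es assume "X es"
    then have es: "indep es" "gen es \<subseteq> V" using gen_subset[OF V(1)] by (auto simp: X_def)
    have "length es < 2 ^ length es" by simp
    also have "(2::nat) ^ length es \<le> 2 ^ wt (map snd es)"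
      using indep_length_le[OF es(1)] by (simp add: power_increasing)
    also have "\<dots> \<le> CARD('a) ^ wt (map snd es)" using two_le_card by (simp add: power_mono)
    also have "\<dots> \<le> card V" using indep_card_gen[OF es(1)] card_mono[OF V(2) es(2)] by simp
    finally show "length es < card V" .
  qed
  ultimately obtain es where es: "X es" "\<And>es'. X es' \<Longrightarrow> length es' \<le> length es"
    using ex_has_greatest_nat[of X ds length "card V"] by blast
  have e: "indep es" "fst ` set es \<subseteq> V" "\<forall>(v, p, k)\<in>set es. j \<le> k" "gen ds \<subseteq> gen es"
    using es(1) by (auto simp: X_def)
  have "\<exists>w\<in>gen es. P ^ (i - 1) *s (v - w) = 0"
    if P: "monic_irred P" and i: "j \<le> i" and v: "v \<in> V" "P ^ i *s v = 0" for P i v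
  proof (cases "i = j")
    case False
    then show ?thesis using sat[OF P _ v] i e(4) by (metis Suc_leI le_neq_implies_less subsetD)
  next
    case True
    have "P ^ (i - 1) *s v \<in> gen es"
    proof (rule ccontr)
      assume "P ^ (i - 1) *s v \<notin> gen es"
      then have "X ((v, P, i) # es)"
        using e P v step(4) True gen_Cons_mono[of es "(v, P, i)"] by (auto simp: X_def)
      then show False using es(2) by fastforce
    qed
    moreover have "P *s P ^ (i - 1) *s v = 0"
      using v(2) step(4) True by (simp flip: power_Suc)
    \<comment> \<open>All exponents in \<open>es\<close> are at least \<open>j\<close>, so this
      vector killed by \<open>P\<close> lifts to some \<open>w\<close>, and subtracting
      \<open>w\<close> lowers the order of \<open>v\<close>.\<close>
    ultimately have "\<exists>w\<in>gen es. P ^ (j - 1) *s w = P ^ (i - 1) *s v"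
      using e P step(4) by (intro socle_lift) auto
    then obtain w where w: "w \<in> gen es" "P ^ (i - 1) *s w = P ^ (i - 1) *s v" using True by blast
    then have "P ^ (i - 1) *s (v - w) = 0" by (simp add: scale_right_diff_distrib)
    then show ?thesis using w(1) by blast
  qed
  then show ?case using e by blast
qed

text \<open>At level 1 the order of every primary vector can be lowered by subtracting an element of
  the span, down to 0; so the span contains all primary vectors and with them
  \<open>V\<close>.\<close>

theorem cyclic_family_exists:
  assumes V: "subspace V" "finite V"
  obtains ds where "indep ds" "fst ` set ds \<subseteq> V" "gen ds = V"
proof -
  obtain ds where ds: "indep ds" "fst ` set ds \<subseteq> V"
    and sat: "\<And>P i v. monic_irred P \<Longrightarrow> 1 \<le> i \<Longrightarrow> v \<in> V \<Longrightarrow> P ^ i *s v = 0 \<Longrightarrow>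
      \<exists>w\<in>gen ds. P ^ (i - 1) *s (v - w) = 0"
    using greedy_family[OF V, of 1] by auto
  have sub: "gen ds \<subseteq> V" using gen_subset V ds by blast
  have "v \<in> gen ds" if P: "monic_irred P" and "v \<in> V" "P ^ i *s v = 0" for P i v
    using that(2,3)
  proof (induction i arbitrary: v)
    case 0
    then show ?case using subspace_0[OF subspace_gen] by simp
  next
    case (Suc i)
    then obtain w where w: "w \<in> gen ds" "P ^ i *s (v - w) = 0" using sat[OF P, of "Suc i" v] by auto
    then have "v - w \<in> gen ds" using Suc sub subspace_diff[OF V(1)] by auto
    then show ?case using w(1) subspace_add[OF subspace_gen, of "v - w" ds w] by simp
  qed
  then have "V \<subseteq> gen ds" using primary_parts_generate[OF V subspace_gen] by blast
  then show ?thesis using that ds sub by blast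
qed

section \<open>Number of independent families with prescribed orders\<close>

definition families :: "'v set \<Rightarrow> ('a poly \<times> nat) list \<Rightarrow> ('v \<times> 'a poly \<times> nat) list set" where
  "families V L = {ds. map snd ds = L \<and> fst ` set ds \<subseteq> V \<and> indep ds}"

definition kernel_card :: "'v set \<Rightarrow> 'a poly \<Rightarrow> nat \<Rightarrow> nat" where
  "kernel_card V p j = card {v \<in> V. p ^ j *s v = 0}"

text \<open>The vectors killed by \<open>p ^ k\<close> that fail the test are counted through
  \<open>v \<mapsto> p ^ (k - 1) *s v\<close>: its values there are the elements of
  \<open>gen ds\<close> killed by \<open>p\<close>, all of them by \<open>socle_lift\<close>, and
  its fibres are cosets of the kernel of \<open>p ^ (k - 1)\<close>.\<close>

lemma card_extensions:
  assumes V: "subspace V" "finite V" and ds: "indep ds" "fst ` set ds \<subseteq> V"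
    and p: "monic_irred p" and k: "1 \<le> k" "\<And>v k'. (v, p, k') \<in> set ds \<Longrightarrow> k \<le> k'"
  shows "real (card {v \<in> V. p ^ k *s v = 0 \<and> p ^ (k - 1) *s v \<notin> gen ds})
    = real (kernel_card V p k)
      - real (kernel_card V p (k - 1)) * real CARD('a) ^ (degree p * minsum p 1 (map snd ds))"
proof -
  let ?A = "{v \<in> V. p ^ k *s v = 0}"
  let ?B = "{v \<in> V. p ^ k *s v = 0 \<and> p ^ (k - 1) *s v \<in> gen ds}"
  let ?S = "{u \<in> gen ds. p ^ 1 *s u = 0}"
  let ?K = "{v \<in> V. p ^ (k - 1) *s v = 0}"
  have sub: "gen ds \<subseteq> V" using gen_subset V ds by blast
  have pk: "p ^ k = p * p ^ (k - 1)" using k(1) by (cases k) auto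
  have "\<exists>w\<in>gen ds. p ^ (k - 1) *s w = u" if "u \<in> ?S" for u
    using that k by (intro socle_lift[OF ds(1) p]) auto
  then have "\<forall>u\<in>?S. \<exists>w. w \<in> gen ds \<and> p ^ (k - 1) *s w = u" by blast
  \<comment> \<open>\<open>l\<close> picks a preimage for each value, which turns the fibration into
    a product.\<close>
  from bchoice[OF this] obtain l where
    l: "\<And>u. u \<in> ?S \<Longrightarrow> l u \<in> gen ds" "\<And>u. u \<in> ?S \<Longrightarrow> p ^ (k - 1) *s l u = u"
    by blast
  have "bij_betw (\<lambda>(u, y). l u + y) (?S \<times> ?K) ?B"
  proof (rule bij_betw_byWitness[where f' = "\<lambda>v. (p ^ (k - 1) *s v, v - l (p ^ (k - 1) *s v))"])
    have *: "p ^ (k - 1) *s (l u + y) = u" if "u \<in> ?S" "y \<in> ?K" for u y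
      using that l(2) by (simp add: scale_right_distrib)
    show "\<forall>a\<in>?S \<times> ?K. (\<lambda>v. (p ^ (k - 1) *s v, v - l (p ^ (k - 1) *s v))) (case a of (u, y) \<Rightarrow> l u + y) = a"
      using * by auto
    show "\<forall>v\<in>?B. (case (p ^ (k - 1) *s v, v - l (p ^ (k - 1) *s v)) of (u, y) \<Rightarrow> l u + y) = v"
      by auto
    have "l u + y \<in> ?B" if uy: "u \<in> ?S" "y \<in> ?K" for u y
    proof -
      have "l u + y \<in> V" using uy l(1) sub subspace_add[OF V(1)] by auto
      moreover have "p ^ k *s (l u + y) = p *s p ^ (k - 1) *s (l u + y)" by (simp add: pk)
      ultimately show ?thesis using *[OF uy] uy(1) by (simp del: scale_scale)
    qed
    then show "(\<lambda>(u, y). l u + y) ` (?S \<times> ?K) \<subseteq> ?B" by auto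
    have "(p ^ (k - 1) *s v, v - l (p ^ (k - 1) *s v)) \<in> ?S \<times> ?K" if v: "v \<in> ?B" for v
    proof -
      have u: "p ^ (k - 1) *s v \<in> ?S" using v by (simp add: pk)
      then show ?thesis
        using l[OF u] v sub subspace_diff[OF V(1)] by (auto simp: scale_right_diff_distrib)
    qed
    then show "(\<lambda>v. (p ^ (k - 1) *s v, v - l (p ^ (k - 1) *s v))) ` ?B \<subseteq> ?S \<times> ?K" by blast
  qed
  then have "card ?B = card (?S \<times> ?K)" by (simp add: bij_betw_same_card)
  then have B: "card ?B = CARD('a) ^ (degree p * minsum p 1 (map snd ds)) * kernel_card V p (k - 1)"
    using indep_card_kernel[OF ds(1) p, of 1]
    by (simp add: card_cartesian_product kernel_card_def)
  have "{v \<in> V. p ^ k *s v = 0 \<and> p ^ (k - 1) *s v \<notin> gen ds} = ?A - ?B" by auto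
  moreover have "real (card (?A - ?B)) = real (card ?A) - real (card ?B)"
    using V(2) by (subst card_Diff_subset) (auto intro!: of_nat_diff card_mono)
  ultimately show ?thesis unfolding B kernel_card_def by simp
qed

text \<open>With exponents sorted upwards the head has the smallest, so
  \<open>card_extensions\<close> applies to every family for the tail. The number of extensions is
  the same for all of them, which makes the total a product.\<close>

lemma card_families:
  assumes V: "subspace V" "finite V"
    and L: "sorted (map snd L)" "\<forall>(p, k)\<in>set L. monic_irred p \<and> 1 \<le> k"
  shows "finite (families V L)" "real (card (families V L)) = family_count (kernel_card V) L"
proof -
  have "finite (families V L) \<and> real (card (families V L)) = family_count (kernel_card V) L"
    using L
  proof (induction L)
    case Nil
    have "families V [] = {[]}" by (auto simp: families_def)
    then show ?case by simp
  next
    case (Cons d L)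
    obtain p k where d: "d = (p, k)" by (cases d)
    have p: "monic_irred p" "1 \<le> k" using Cons d by auto
    define E where "E = (\<lambda>ds. {v \<in> V. p ^ k *s v = 0 \<and> p ^ (k - 1) *s v \<notin> gen ds})"
    have IH: "finite (families V L)" "real (card (families V L)) = family_count (kernel_card V) L"
      using Cons by auto
    have eq: "families V (d # L) = (\<lambda>(ds, v). (v, p, k) # ds) ` (SIGMA ds:families V L. E ds)"
      (is "_ = ?f ` ?S")
    proof (intro subset_antisym subsetI)
      fix es assume es: "es \<in> families V (d # L)"
      then obtain v ds where "es = (v, p, k) # ds" by (cases es) (auto simp: families_def d)
      then show "es \<in> ?f ` ?S" using es
        by (intro image_eqI[of _ _ "(ds, v)"]) (auto simp: families_def d E_def)
    qed (use p in \<open>auto simp: families_def d E_def image_subset_iff\<close>)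
    have fin: "finite (E ds)" for ds using V(2) by (simp add: E_def)
    have "card (families V (d # L)) = card ?S"
      unfolding eq by (rule card_image) (auto simp: inj_on_def)
    also have "\<dots> = (\<Sum>ds\<in>families V L. card (E ds))"
      using IH(1) fin by simp
    finally have "real (card (families V (d # L))) = (\<Sum>ds\<in>families V L. real (card (E ds)))" by simp
    also have "\<dots> = (\<Sum>ds\<in>families V L. real (kernel_card V p k)
        - real (kernel_card V p (k - 1)) * real CARD('a) ^ (degree p * minsum p 1 L))"
    proof (rule sum.cong[OF refl])
      fix ds assume ds: "ds \<in> families V L"
      have "k \<le> k'" if "(v, p, k') \<in> set ds" for v k'
      proof -
        have "(p, k') \<in> set L" using ds that by (force simp: families_def)
        then show ?thesis using Cons.prems(1) d by force
      qed
      then show "real (card (E ds)) = real (kernel_card V p k)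
        - real (kernel_card V p (k - 1)) * real CARD('a) ^ (degree p * minsum p 1 L)"
        using card_extensions[OF V _ _ p] ds unfolding E_def families_def by auto
    qed
    also have "\<dots> = family_count (kernel_card V) (d # L)" using IH(2) by (simp add: d)
    finally show ?case unfolding eq using IH(1) fin by auto
  qed
  then show "finite (families V L)" "real (card (families V L)) = family_count (kernel_card V) L"
    by auto
qed

end

section \<open>Evaluation of the counting formula\<close>

definition shape_data :: "('a::field poly \<times> nat) list \<Rightarrow> 'a poly \<Rightarrow> nat multiset" where
  "shape_data L p = mset (map snd (filter (\<lambda>d. fst d = p) L))"

lemma shape_data_Nil [simp]: "shape_data [] p = {#}"
  and shape_data_Cons [simp]:
    "shape_data ((p, k) # L) P = (if p = P then add_mset k (shape_data L P) else shape_data L P)"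
  by (simp_all add: shape_data_def)

lemma part_conj_empty [simp]: "part_conj {#} i = 0"
  and part_conj_add_mset [simp]:
    "part_conj (add_mset k M) i = (if i \<le> k then Suc (part_conj M i) else part_conj M i)"
  by (simp_all add: part_conj_def)

lemma count_shape_data: "count (shape_data L p) k = count (mset L) (p, k)"
  by (induction L) (auto split: if_splits)

lemma shape_data_empty_iff: "shape_data L p = {#} \<longleftrightarrow> p \<notin> fst ` set L"
  by (induction L) (force split: if_splits)+

lemma shape_data_part_le: "(p, k) \<in> set L \<Longrightarrow> k \<le> sum_mset (shape_data L p)"
  by (induction L) auto

text \<open>\<open>min k k'\<close> is the number of \<open>i\<close> from 1 to \<open>k\<close>
  with \<open>i \<le> k'\<close>, so the sum over parts becomes a sum over columns of the
  diagram.\<close>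

lemma minsum_part_conj: "minsum p k L = (\<Sum>i\<in>{1..k}. part_conj (shape_data L p) i)"
proof (induction L)
  case (Cons d L)
  obtain p' k' where d: "d = (p', k')" by (cases d)
  have "(\<Sum>i\<in>{1..k}. if i \<le> k' then Suc (c i) else c i) = min k k' + (\<Sum>i\<in>{1..k}. c i)" for c :: "nat \<Rightarrow> nat"
  proof -
    have "(\<Sum>i\<in>{1..k}. if i \<le> k' then Suc (c i) else c i) = (\<Sum>i\<in>{1..k}. (if i \<le> k' then 1 else 0) + c i)"
      by (rule sum.cong) auto
    also have "\<dots> = card {i \<in> {1..k}. i \<le> k'} + (\<Sum>i\<in>{1..k}. c i)"
      by (simp add: sum.distrib sum.If_cases Int_def)
    also have "{i \<in> {1..k}. i \<le> k'} = {1..min k k'}" by auto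
    finally show ?thesis by simp
  qed
  then show ?case using Cons by (simp add: d)
qed simp

text \<open>Differences of \<open>minsum\<close> in \<open>j\<close> give the conjugate parts, and
  differences of those give the multiplicities. Parts equal to 0 leave no trace in
  \<open>minsum\<close> and are excluded by the positivity of the exponents.\<close>

lemma shape_data_eqI:
  assumes "\<forall>d\<in>set L. 1 \<le> snd d" "\<forall>d\<in>set L'. 1 \<le> snd d"
    and "\<And>j. minsum p j L = minsum p j L'"
  shows "shape_data L p = shape_data L' p"
proof (rule multiset_eqI)
  have conj: "part_conj (shape_data L p) (Suc i) = part_conj (shape_data L' p) (Suc i)" for i
    using assms(3)[of i] assms(3)[of "Suc i"] by (simp add: minsum_part_conj)
  have part: "part_conj M i = count M i + part_conj M (Suc i)" for M i
    by (induction M) auto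
  fix k
  show "count (shape_data L p) k = count (shape_data L' p) k"
  proof (cases k)
    case 0
    have "(p, 0) \<notin> set L" "(p, 0) \<notin> set L'" using assms(1,2) by force+
    then have "count (mset L) (p, 0) = 0" "count (mset L') (p, 0) = 0" by (metis count_mset_0_iff)+
    then show ?thesis by (simp only: 0 count_shape_data)
  next
    case (Suc i)
    then show ?thesis using part[of "shape_data L p" k] part[of "shape_data L' p" k] conj by simp
  qed
qed

section \<open>Factoring the product of choices\<close>

lemma minsum_append [simp]: "minsum p j (L @ L') = minsum p j L + minsum p j L'"
  by (simp add: minsum_def)

text \<open>Raising the level from \<open>k - 1\<close> to \<open>k\<close> adds 1 for each entry of
  \<open>p\<close> with exponent at least \<open>k\<close>: here these are the copies of
  \<open>(p, k)\<close>, in \<open>minsum_step_large\<close> they are all entries of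
  \<open>p\<close>.\<close>

lemma minsum_step_small:
  assumes "1 \<le> k" "\<forall>d\<in>set L. snd d \<le> k"
  shows "minsum p k L = minsum p (k - 1) L + count (mset L) (p, k)"
  using assms(2) by (induction L) (use assms(1) in \<open>auto simp: min_def split: if_splits\<close>)

lemma minsum_step_large:
  assumes "1 \<le> k" "\<forall>d\<in>set L. k \<le> snd d"
  shows "minsum p k L = minsum p (k - 1) L + minsum p 1 L"
  using assms(2) by (induction L) (use assms(1) in \<open>auto simp: min_def split: if_splits\<close>)

text \<open>The \<open>j\<close>-th occurrence of \<open>d\<close> contributes
  \<open>1 - x d ^ j\<close>, where \<open>M\<close> records what came before; over a whole list
  each \<open>d\<close> collects the q-Pochhammer factor of its multiplicity.\<close>

fun qpoch_steps :: "('d \<Rightarrow> real) \<Rightarrow> 'd multiset \<Rightarrow> 'd list \<Rightarrow> real" where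
  "qpoch_steps x M [] = 1"
| "qpoch_steps x M (d # L) = (1 - x d ^ Suc (count M d)) * qpoch_steps x (add_mset d M) L"

lemma qpoch_Suc: "qpoch x (Suc n) = qpoch x n * (1 - x ^ Suc n)"
  by (simp add: qpoch_def)

lemma qpoch_steps_prod:
  assumes "finite A" "set L \<subseteq> A"
  shows "qpoch_steps x M L * (\<Prod>d\<in>A. qpoch (x d) (count M d))
    = (\<Prod>d\<in>A. qpoch (x d) (count (M + mset L) d))"
  using assms(2)
proof (induction L arbitrary: M)
  case (Cons d L)
  have d: "d \<in> A" using Cons by simp
  have "(1 - x d ^ Suc (count M d)) * (\<Prod>e\<in>A. qpoch (x e) (count M e))
      = (\<Prod>e\<in>A. qpoch (x e) (count (add_mset d M) e))"
    unfolding prod.remove[OF assms(1) d]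
    by (simp add: qpoch_Suc mult.commute mult.left_commute)
      (auto intro!: disjI2 prod.cong split: if_splits)
  moreover have "qpoch_steps x M (d # L) * (\<Prod>e\<in>A. qpoch (x e) (count M e))
      = qpoch_steps x (add_mset d M) L * ((1 - x d ^ Suc (count M d)) * (\<Prod>e\<in>A. qpoch (x e) (count M e)))"
    by simp
  ultimately have "qpoch_steps x M (d # L) * (\<Prod>e\<in>A. qpoch (x e) (count M e))
      = qpoch_steps x (add_mset d M) L * (\<Prod>e\<in>A. qpoch (x e) (count (add_mset d M) e))"
    by (simp only:)
  also have "\<dots> = (\<Prod>e\<in>A. qpoch (x e) (count (add_mset d M + mset L) e))"
    using Cons.prems by (intro Cons.IH) simp
  finally show ?case by simp
qed simp

text \<open>Passing from \<open>K p (k - 1)\<close> to \<open>K p k\<close> multiplies by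
  \<open>q ^ degree p\<close> to the power \<open>c + 1 + minsum p 1 L\<close>, with
  \<open>L\<close> the tail and \<open>c\<close> the number of earlier copies of
  \<open>(p, k)\<close>. Extracting \<open>K p k\<close> from the factor of the head leaves
  \<open>1 - q ^ (- degree p * (c + 1))\<close>. \<open>K\<close> belongs to the whole list, hence
  the prefix \<open>pre\<close>.\<close>

lemma family_count_split:
  fixes L :: "('a::{finite,field} poly \<times> nat) list"
  assumes "sorted (map snd (pre @ L))" "\<forall>d\<in>set (pre @ L). 1 \<le> snd d"
    and "K = (\<lambda>p k. CARD('a) ^ (degree p * minsum p k (pre @ L)))"
  shows "family_count K L =
    (\<Prod>(p, k)\<leftarrow>L. real CARD('a) ^ (degree p * minsum p k (pre @ L))) *
    qpoch_steps (\<lambda>d. 1 / real CARD('a) ^ degree (fst d)) (mset pre) L"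
  using assms
proof (induction L arbitrary: pre)
  case (Cons d L)
  obtain p k where d: "d = (p, k)" by (cases d)
  let ?q = "real CARD('a)"
  let ?W = "pre @ d # L"
  let ?c = "count (mset pre) d"
  have IH: "family_count K L = (\<Prod>(p, k)\<leftarrow>L. ?q ^ (degree p * minsum p k ?W)) *
      qpoch_steps (\<lambda>d. 1 / ?q ^ degree (fst d)) (add_mset d (mset pre)) L"
    using Cons.IH[of "pre @ [d]"] Cons.prems by simp
  have k: "1 \<le> k" and le: "\<forall>e\<in>set pre. snd e \<le> k" "\<forall>e\<in>set L. k \<le> snd e"
    using Cons.prems d by (auto simp: sorted_append)
  \<comment> \<open>Prefix entries of \<open>p\<close> with exponent at least \<open>k\<close> are
    copies of \<open>(p, k)\<close>, the head counts once, and the tail contributes all its entries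
    of \<open>p\<close>.\<close>
  have M: "minsum p k ?W = minsum p (k - 1) ?W + (?c + 1 + minsum p 1 L)"
    using minsum_step_small[OF k le(1), of p] minsum_step_large[OF k le(2), of p] k
    by (simp add: d)
  have "real (K p k) = ?q ^ (degree p * (minsum p (k - 1) ?W + (?c + 1 + minsum p 1 L)))"
    by (simp only: Cons.prems(3) M of_nat_power)
  also have "\<dots> = ?q ^ (degree p * minsum p (k - 1) ?W) * ?q ^ (degree p * minsum p 1 L) * (?q ^ degree p) ^ Suc ?c"
    by (simp add: add_mult_distrib2 power_add power_mult del: minsum_append)
  also have "?q ^ (degree p * minsum p (k - 1) ?W) = real (K p (k - 1))"
    by (simp only: Cons.prems(3) of_nat_power)
  finally have K: "real (K p k) = real (K p (k - 1)) * ?q ^ (degree p * minsum p 1 L) * (?q ^ degree p) ^ Suc ?c" .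
  have "(?q ^ degree p) ^ Suc ?c \<noteq> 0" by simp
  then have F: "real (K p k) - real (K p (k - 1)) * ?q ^ (degree p * minsum p 1 L)
      = real (K p k) * (1 - (1 / ?q ^ degree p) ^ Suc ?c)"
    unfolding K by (simp add: field_simps power_one_over)
  have G: "real (K p k) = ?q ^ (degree p * minsum p k ?W)" using Cons.prems(3) by simp
  have "family_count K (d # L) = real (K p k) * (1 - (1 / ?q ^ degree p) ^ Suc ?c) * family_count K L"
    using F by (simp only: d family_count.simps)
  then show ?case unfolding IH G by (simp add: d)
qed simp

text \<open>A bilinear form of the sum of squares: the list \<open>L'\<close> summed over and the
  list \<open>L\<close> inside \<open>minsum\<close> are kept apart so that induction runs over
  \<open>L'\<close> alone; \<open>L' = L\<close> gives the squares.\<close>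

lemma square_sum_shape:
  assumes "finite S" "fst ` set L' \<subseteq> S" "\<And>p k. (p, k) \<in> set L' \<Longrightarrow> k \<le> b p"
  shows "(\<Sum>(p, k)\<leftarrow>L'. degree p * minsum p k L)
    = (\<Sum>p\<in>S. degree p * (\<Sum>i\<in>{1..b p}. part_conj (shape_data L' p) i * part_conj (shape_data L p) i))"
  using assms(2,3)
proof (induction L')
  case (Cons d L')
  obtain p k where d: "d = (p, k)" by (cases d)
  let ?c = "\<lambda>p i. part_conj (shape_data L p) i" and ?c' = "\<lambda>p i. part_conj (shape_data L' p) i"
  have p: "p \<in> S" and k: "k \<le> b p" using Cons d by auto
  have *: "(\<Sum>i\<in>{1..b p}. part_conj (shape_data (d # L') p) i * ?c p i)
      = minsum p k L + (\<Sum>i\<in>{1..b p}. ?c' p i * ?c p i)"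
  proof -
    have "(\<Sum>i\<in>{1..b p}. part_conj (shape_data (d # L') p) i * ?c p i)
        = (\<Sum>i\<in>{1..b p}. (if i \<le> k then ?c p i else 0) + ?c' p i * ?c p i)"
      by (rule sum.cong) (auto simp: d)
    also have "\<dots> = (\<Sum>i\<in>{1..b p} \<inter> {i. i \<le> k}. ?c p i) + (\<Sum>i\<in>{1..b p}. ?c' p i * ?c p i)"
      by (simp add: sum.distrib sum.If_cases)
    also have "{1..b p} \<inter> {i. i \<le> k} = {1..k}" using k by auto
    finally show ?thesis by (simp add: minsum_part_conj)
  qed
  have "(\<Sum>P\<in>S. degree P * (\<Sum>i\<in>{1..b P}. part_conj (shape_data (d # L') P) i * ?c P i))
      = degree p * minsum p k L + (\<Sum>P\<in>S. degree P * (\<Sum>i\<in>{1..b P}. ?c' P i * ?c P i))"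
    unfolding sum.remove[OF assms(1) p] * by (auto simp: d add_mult_distrib2 intro!: sum.cong)
  then show ?case using Cons by (simp add: d)
qed simp

lemma prod_list_power: "(\<Prod>d\<leftarrow>L. q ^ f d) = q ^ (\<Sum>d\<leftarrow>L. f d)" for q :: real
  by (induction L) (auto simp: power_add)

theorem family_count_rcf_denom:
  fixes L :: "('a::{finite,field} poly \<times> nat) list"
  assumes "sorted (map snd L)" "\<forall>(p, k)\<in>set L. monic_irred p \<and> p \<noteq> [:0, 1:] \<and> 1 \<le> k"
  shows "family_count (\<lambda>p k. CARD('a) ^ (degree p * minsum p k L)) L
    = rcf_denom (real CARD('a)) (shape_data L)"
proof -
  let ?q = "real CARD('a)"
  let ?x = "\<lambda>d :: 'a poly \<times> nat. 1 / ?q ^ degree (fst d)"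
  define S where "S = fst ` set L"
  define b where "b p = sum_mset (shape_data L p)" for p
  \<comment> \<open>The index set of the double product in \<open>rcf_denom\<close>. It contains all
    entries of \<open>L\<close>; pairs that do not occur have multiplicity 0 and contribute
    1.\<close>
  define A where "A = (SIGMA p:S. {1..b p})"
  have fin: "finite S" "finite A" by (auto simp: S_def A_def)
  have S: "{p. monic_irred p \<and> p \<noteq> [:0, 1:] \<and> shape_data L p \<noteq> {#}} = S"
    using assms(2) unfolding shape_data_empty_iff S_def by fastforce
  have sub: "set L \<subseteq> A"
    using assms(2) shape_data_part_le[of _ _ L] by (force simp: A_def S_def b_def)
  have "(\<Prod>(p, k)\<leftarrow>L. ?q ^ (degree p * minsum p k L)) = ?q ^ (\<Sum>(p, k)\<leftarrow>L. degree p * minsum p k L)"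
    using prod_list_power[of ?q "\<lambda>(p, k). degree p * minsum p k L" L] by (simp add: case_prod_unfold)
  also have "(\<Sum>(p, k)\<leftarrow>L. degree p * minsum p k L)
      = (\<Sum>p\<in>S. degree p * (\<Sum>i\<in>{1..b p}. part_conj (shape_data L p) i * part_conj (shape_data L p) i))"
    using fin shape_data_part_le[of _ _ L] by (intro square_sum_shape) (auto simp: S_def b_def)
  also have "?q ^ \<dots> = (\<Prod>p\<in>S. ?q ^ (degree p * (\<Sum>i\<in>{1..b p}. (part_conj (shape_data L p) i)\<^sup>2)))"
    by (simp add: power_sum power2_eq_square)
  finally have 1: "(\<Prod>(p, k)\<leftarrow>L. ?q ^ (degree p * minsum p k L)) = \<dots>" .
  have "qpoch_steps ?x {#} L = (\<Prod>d\<in>A. qpoch (?x d) (count (mset L) d))"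
    using qpoch_steps_prod[OF fin(2) sub, of ?x "{#}"] by (simp add: qpoch_def)
  also have "\<dots> = (\<Prod>p\<in>S. \<Prod>i\<in>{1..b p}. qpoch (1 / ?q ^ degree p) (part_mult (shape_data L p) i))"
    unfolding A_def using fin(1)
    by (subst prod.Sigma) (auto simp: part_mult_def count_shape_data case_prod_unfold intro!: prod.cong)
  finally have 2: "qpoch_steps ?x {#} L = \<dots>" .
  have "family_count (\<lambda>p k. CARD('a) ^ (degree p * minsum p k L)) L
      = (\<Prod>(p, k)\<leftarrow>L. ?q ^ (degree p * minsum p k L)) * qpoch_steps ?x {#} L"
    using family_count_split[of "[]" L] assms(1,2) by force
  then show ?thesis unfolding rcf_denom_def S 1 2 b_def by (simp add: prod.distrib)
qed

section \<open>The module of a matrix\<close>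

text \<open>Vectors of length \<open>m\<close> are stored as polynomials of degree less than \<open>m\<close>, merely to have all
  of them in one additive group, so that the module theory above applies.\<close>

definition emb :: "'a::zero vec \<Rightarrow> 'a poly" where
  "emb v = Poly (map (($) v) [0..<dim_vec v])"

abbreviation sc :: "'a::field \<Rightarrow> 'a poly \<Rightarrow> 'a poly" where
  "sc \<equiv> Polynomial.smult"

interpretation fs: Modules.module sc
  by unfold_locales (auto simp: smult_add_right smult_add_left)

lemma coeff_emb: "coeff (emb v) i = (if i < dim_vec v then v $ i else 0)"
  by (simp add: emb_def nth_default_def)

lemma emb_vec: "f \<in> polys_below m \<Longrightarrow> emb (vec m (coeff f)) = f"
  by (auto simp: poly_eq_iff coeff_emb polys_below_def)

lemma vec_emb: "v \<in> carrier_vec m \<Longrightarrow> vec m (coeff (emb v)) = v"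
  by (auto simp: coeff_emb)

lemma emb_below: "v \<in> carrier_vec m \<Longrightarrow> emb v \<in> polys_below m"
  by (auto simp: coeff_emb polys_below_def)

lemma emb_inj: "v \<in> carrier_vec m \<Longrightarrow> w \<in> carrier_vec m \<Longrightarrow> emb v = emb w \<longleftrightarrow> v = w"
  by (metis vec_emb)

lemma emb_image: "emb ` carrier_vec m = polys_below m"
proof (intro subset_antisym subsetI)
  fix f :: "'a poly" assume "f \<in> polys_below m"
  then have "f = emb (vec m (coeff f))" by (simp add: emb_vec)
  then show "f \<in> emb ` carrier_vec m" by (rule image_eqI) simp
qed (auto simp: emb_below)

lemma emb_zero: "emb (0\<^sub>v m) = 0"
  by (auto simp: poly_eq_iff coeff_emb)

lemma emb_add: "v \<in> carrier_vec m \<Longrightarrow> w \<in> carrier_vec m \<Longrightarrow> emb (v + w) = emb v + emb w"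
  for v :: "'a::field vec"
  by (auto simp: poly_eq_iff coeff_emb)

lemma emb_smult: "emb (c \<cdot>\<^sub>v v) = sc c (emb v)"
  by (auto simp: poly_eq_iff coeff_emb)

lemma finite_carrier_vec: "finite (carrier_vec m :: 'a::{finite,field} vec set)"
  and card_carrier_vec: "card (carrier_vec m :: 'a::{finite,field} vec set) = CARD('a) ^ m"
proof -
  have "inj_on emb (carrier_vec m :: 'a vec set)" by (auto simp: inj_on_def emb_inj)
  then have "bij_betw emb (carrier_vec m :: 'a vec set) (polys_below m)"
    by (simp add: bij_betw_def emb_image)
  then show "finite (carrier_vec m :: 'a vec set)" "card (carrier_vec m :: 'a vec set) = CARD('a) ^ m"
    using polys_below_card bij_betw_finite bij_betw_same_card by metis+
qed

text \<open>Coefficients from index \<open>m\<close> on are discarded, so the map is linear on all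
  polynomials and the module laws hold without side conditions; the module of interest is the
  submodule \<open>polys_below m\<close>.\<close>

definition mat_endo :: "nat \<Rightarrow> 'a::field mat \<Rightarrow> 'a poly \<Rightarrow> 'a poly" where
  "mat_endo m x f = emb (x *\<^sub>v vec m (coeff f))"

definition pact :: "('a::field poly \<Rightarrow> 'a poly) \<Rightarrow> 'a poly \<Rightarrow> 'a poly \<Rightarrow> 'a poly" where
  "pact T p f = (\<Sum>i\<le>degree p. sc (coeff p i) ((T ^^ i) f))"

lemma pact_0 [simp]: "pact T 0 f = 0"
  by (simp add: pact_def)

locale mat_action =
  fixes m :: nat and x :: "'a::{finite,field} mat"
  assumes x: "x \<in> carrier_mat m m"
begin

abbreviation T :: "'a poly \<Rightarrow> 'a poly" where "T \<equiv> mat_endo m x"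

lemma T_add: "T (f + g) = T f + T g"
proof -
  have "vec m (coeff (f + g)) = vec m (coeff f) + vec m (coeff g)" by auto
  then show ?thesis
    unfolding mat_endo_def using x
    by (simp add: mult_add_distrib_mat_vec[of _ m m] emb_add[of _ m])
qed

lemma T_sc: "T (sc c f) = sc c (T f)"
proof -
  have "vec m (coeff (sc c f)) = c \<cdot>\<^sub>v vec m (coeff f)" by auto
  then show ?thesis
    unfolding mat_endo_def using x by (simp add: mult_mat_vec[of _ m m] emb_smult)
qed

lemma T_0: "T 0 = 0"
  using T_sc[of 0 0] by simp

lemma T_sum: "T (\<Sum>i\<in>A. g i) = (\<Sum>i\<in>A. T (g i))"
  by (induction A rule: infinite_finite_induct) (auto simp: T_add T_0)

text \<open>Horner's rule. With it the laws of the action follow by induction on the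
  polynomial.\<close>

lemma pact_pCons: "pact T (pCons a p) f = sc a f + T (pact T p f)"
proof (cases "p = 0")
  case True
  then show ?thesis by (simp add: pact_def T_0)
next
  case False
  have "pact T (pCons a p) f = sc a f + (\<Sum>i\<le>degree p. sc (coeff p i) ((T ^^ Suc i) f))"
    using False unfolding pact_def by (simp add: sum.atMost_Suc_shift del: sum.atMost_Suc)
  also have "(\<Sum>i\<le>degree p. sc (coeff p i) ((T ^^ Suc i) f)) = T (pact T p f)"
    by (simp add: pact_def T_sum T_sc)
  finally show ?thesis .
qed

lemma pact_add: "pact T (p + r) f = pact T p f + pact T r f"
  by (induction p r rule: poly_induct2) (simp_all add: pact_pCons T_add fs.scale_left_distrib)

lemma pact_smult: "pact T (smult a p) f = sc a (pact T p f)"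
  by (induction p) (simp_all add: pact_pCons T_sc fs.scale_right_distrib)

lemma pact_mult: "pact T (p * r) f = pact T p (pact T r f)"
  by (induction p) (simp_all add: pact_pCons pact_add pact_smult)

lemma pact_distrib: "pact T p (f + g) = pact T p f + pact T p g"
  by (induction p) (simp_all add: pact_pCons T_add fs.scale_right_distrib algebra_simps)

lemma pact_monom: "pact T (monom 1 t) f = (T ^^ t) f"
  by (induction t) (simp_all add: pact_pCons monom_0 monom_Suc T_0)

sublocale poly_module "pact T"
proof
  show "pact T 1 f = f" for f
    using pact_monom[of 0 f] by simp
qed (simp_all add: pact_add pact_mult pact_distrib)

lemma pact_const: "pact T [:c:] f = sc c f"
  by (simp add: pact_pCons T_0)

lemma pact_linear: "pact T [:- a, 1:] f = T f - sc a f"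
proof -
  have "pact T [:- a, 1:] f = sc (- a) f + T (sc 1 f)" by (simp add: pact_pCons T_0)
  then show ?thesis by simp
qed

lemma T_emb: "v \<in> carrier_vec m \<Longrightarrow> T (emb v) = emb (x *\<^sub>v v)"
  by (simp add: mat_endo_def vec_emb)

lemma pow_carrier: "x ^\<^sub>m t \<in> carrier_mat m m"
  using x by simp

lemma T_power_emb: "v \<in> carrier_vec m \<Longrightarrow> (T ^^ t) (emb v) = emb (x ^\<^sub>m t *\<^sub>v v)"
proof (induction t arbitrary: v)
  case 0
  then show ?case using x by simp
next
  case (Suc t)
  have "(T ^^ Suc t) (emb v) = (T ^^ t) (emb (x *\<^sub>v v))"
    using Suc.prems by (simp add: funpow_swap1 T_emb)
  also have "\<dots> = emb (x ^\<^sub>m t *\<^sub>v (x *\<^sub>v v))"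
    using Suc x by (intro Suc.IH) simp
  also have "x ^\<^sub>m t *\<^sub>v (x *\<^sub>v v) = x ^\<^sub>m Suc t *\<^sub>v v"
    using assoc_mult_mat_vec[OF pow_carrier x Suc.prems] by simp
  finally show ?case .
qed

lemma poly_act_carrier: "v \<in> carrier_vec m \<Longrightarrow> poly_act x p v \<in> carrier_vec m"
  by (simp add: poly_act_def)

lemma emb_poly_act:
  assumes v: "v \<in> carrier_vec m"
  shows "emb (poly_act x p v) = pact T p (emb v)"
proof (rule poly_eqI)
  fix r
  have "coeff (pact T p (emb v)) r = (\<Sum>i\<le>degree p. coeff p i * coeff (emb (x ^\<^sub>m i *\<^sub>v v)) r)"
    unfolding pact_def coeff_sum T_power_emb[OF v] by simp
  then show "coeff (emb (poly_act x p v)) r = coeff (pact T p (emb v)) r"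
    using v x pow_carrier by (auto simp: poly_act_def coeff_emb)
qed

lemma subspace_below: "subspace (polys_below m)"
proof (rule subspaceI)
  show "0 \<in> polys_below m" by (simp add: polys_below_def)
  show "f + g \<in> polys_below m" if "f \<in> polys_below m" "g \<in> polys_below m" for f g :: "'a poly"
    using that by (simp add: polys_below_def)
  show "pact T p f \<in> polys_below m" if f: "f \<in> polys_below m" for p f
    using emb_poly_act[of "vec m (coeff f)" p] emb_below[OF poly_act_carrier[of "vec m (coeff f)" p]] emb_vec[OF f]
    by simp
qed

abbreviation E :: "('a vec \<times> 'a poly \<times> nat) list \<Rightarrow> ('a poly \<times> 'a poly \<times> nat) list" where
  "E ds \<equiv> map (apfst emb) ds"

lemma length_cyc_vectors: "length (cyc_vectors x ds) = wt (map snd ds)"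
  by (induction ds) (auto simp: cyc_vectors_def)

lemma set_cyc_vectors:
  "set (cyc_vectors x ds) = {x ^\<^sub>m t *\<^sub>v v |v p k t. (v, p, k) \<in> set ds \<and> t < k * degree p}"
proof (intro subset_antisym subsetI)
  fix w assume "w \<in> set (cyc_vectors x ds)"
  then obtain v p k where d: "(v, p, k) \<in> set ds"
    and "w \<in> set (map (\<lambda>t. x ^\<^sub>m t *\<^sub>v v) [0..<k * degree p])"
    by (auto simp: cyc_vectors_def)
  then obtain t where "t < k * degree p" "w = x ^\<^sub>m t *\<^sub>v v" by auto
  then show "w \<in> {x ^\<^sub>m t *\<^sub>v v |v p k t. (v, p, k) \<in> set ds \<and> t < k * degree p}" using d by blast
next
  fix w assume "w \<in> {x ^\<^sub>m t *\<^sub>v v |v p k t. (v, p, k) \<in> set ds \<and> t < k * degree p}"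
  then obtain v p k t where "(v, p, k) \<in> set ds" "t < k * degree p" "w = x ^\<^sub>m t *\<^sub>v v" by blast
  then show "w \<in> set (cyc_vectors x ds)"
    unfolding cyc_vectors_def by (auto intro!: bexI[of _ "(v, p, k)"])
qed

lemma killed_E_iff:
  assumes "fst ` set ds \<subseteq> carrier_vec m"
  shows "killed (E ds) \<longleftrightarrow>
    (\<forall>(v, p, k)\<in>set ds. monic_irred p \<and> 1 \<le> k \<and> poly_act x (p ^ k) v = 0\<^sub>v m)"
proof -
  have "poly_act x (p ^ k) v = 0\<^sub>v m \<longleftrightarrow> pact T (p ^ k) (emb v) = 0" if "(v, p, k) \<in> set ds" for v p k
  proof -
    have v: "v \<in> carrier_vec m" using assms that by force
    show ?thesis
      using emb_inj[OF poly_act_carrier[OF v] zero_carrier_vec] emb_poly_act[OF v] by (simp add: emb_zero)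
  qed
  then show ?thesis by (fastforce simp: killed_def)
qed

text \<open>\<open>p ^ k\<close> is monic of degree \<open>k * degree p\<close>, so killing
  \<open>f\<close> expresses the top power through the lower ones.\<close>

lemma top_power_eq:
  assumes p: "monic_irred p" and kill: "pact T (p ^ k) f = 0"
  shows "(T ^^ (k * degree p)) f = - (\<Sum>i<k * degree p. sc (coeff (p ^ k) i) ((T ^^ i) f))"
proof -
  let ?d = "k * degree p"
  have lead: "coeff (p ^ k) ?d = 1"
    using p monic_irred_degree_power[OF p, of k] lead_coeff_power[of p k] by (simp add: monic_irred_def)
  have "pact T (p ^ k) f = (\<Sum>i<?d. sc (coeff (p ^ k) i) ((T ^^ i) f)) + (T ^^ ?d) f"
    unfolding pact_def monic_irred_degree_power[OF p] using lead
    by (simp add: lessThan_Suc_atMost[symmetric])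
  then show ?thesis using kill by (simp add: eq_neg_iff_add_eq_0 add.commute)
qed

lemma top_power_in_span:
  assumes "monic_irred p" "pact T (p ^ k) f = 0"
  shows "(T ^^ (k * degree p)) f \<in> fs.span {(T ^^ t) f |t. t < k * degree p}"
  unfolding top_power_eq[OF assms]
  by (intro fs.span_neg fs.span_sum fs.span_scale fs.span_base) auto

text \<open>The linear span of the cyclic vectors is already a submodule: \<open>T\<close> moves
  each to the next power, and the last one falls back on the lower powers by
  \<open>top_power_in_span\<close>. The basis condition in \<open>cyclic_decomp\<close> thereby
  becomes one on generated submodules.\<close>

lemma gen_E_eq_span:
  assumes c: "fst ` set ds \<subseteq> carrier_vec m" and k: "killed (E ds)"
  shows "gen (E ds) = fs.span (emb ` set (cyc_vectors x ds))"
proof (intro subset_antisym)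
  let ?S = "emb ` set (cyc_vectors x ds)"
  have S: "?S = {(T ^^ t) (emb v) |v p k t. (v, p, k) \<in> set ds \<and> t < k * degree p}"
  proof -
    have e: "(T ^^ t) (emb v) = emb (x ^\<^sub>m t *\<^sub>v v)" if "(v, p, k) \<in> set ds" for v p k t
      using c that by (intro T_power_emb) auto
    show ?thesis
    proof (intro subset_antisym subsetI)
      fix f assume "f \<in> ?S"
      then obtain v p k t where "(v, p, k) \<in> set ds" "t < k * degree p" "f = emb (x ^\<^sub>m t *\<^sub>v v)"
        unfolding set_cyc_vectors by blast
      then show "f \<in> {(T ^^ t) (emb v) |v p k t. (v, p, k) \<in> set ds \<and> t < k * degree p}"
        by (auto simp flip: e)
    next
      fix f assume "f \<in> {(T ^^ t) (emb v) |v p k t. (v, p, k) \<in> set ds \<and> t < k * degree p}"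
      then obtain v p k t where d: "(v, p, k) \<in> set ds" "t < k * degree p" "f = emb (x ^\<^sub>m t *\<^sub>v v)"
        using e by auto
      then have "x ^\<^sub>m t *\<^sub>v v \<in> set (cyc_vectors x ds)" unfolding set_cyc_vectors by blast
      then show "f \<in> ?S" using d(3) by simp
    qed
  qed
  show "fs.span ?S \<subseteq> gen (E ds)"
  proof (rule fs.span_minimal)
    show "fs.subspace (gen (E ds))"
    proof (rule fs.subspaceI)
      show "sc c f \<in> gen (E ds)" if "f \<in> gen (E ds)" for c f
        using subspace_scale[OF subspace_gen that, of "[:c:]"] by (simp add: pact_const)
    qed (use subspace_gen in \<open>auto intro: subspace_0 subspace_add\<close>)
    have "(T ^^ t) (emb v) \<in> gen (E ds)" if "(v, p, k) \<in> set ds" for v p k t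
    proof -
      have "emb v \<in> gen (E ds)" unfolding gen_def using that by (force intro: span_base)
      then show ?thesis using subspace_scale[OF subspace_gen, of "emb v" "E ds" "monom 1 t"]
        by (simp add: pact_monom)
    qed
    then show "?S \<subseteq> gen (E ds)" unfolding S by blast
  qed
  have TS: "T f \<in> fs.span ?S" if "f \<in> fs.span ?S" for f
    using that
  proof (induction rule: fs.span_induct_alt)
    case base
    then show ?case by (simp add: T_0 fs.span_zero)
  next
    case (step c f g)
    then obtain v p k t where v: "(v, p, k) \<in> set ds" "t < k * degree p" "f = (T ^^ t) (emb v)"
      unfolding S by blast
    have "T f \<in> fs.span ?S"
    proof (cases "Suc t < k * degree p")
      case True
      then have "(T ^^ Suc t) (emb v) \<in> ?S" unfolding S using v(1) by blast
      then show ?thesis using v(3) by (auto intro: fs.span_base)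
    next
      case False
      then have "T f = (T ^^ (k * degree p)) (emb v)"
        using v(2,3) by (metis Suc_lessI comp_apply funpow.simps(2))
      moreover have "monic_irred p" "pact T (p ^ k) (emb v) = 0"
        using k v(1) by (auto simp: killed_def)
      note top_power_in_span[OF this]
      ultimately have "T f \<in> fs.span {(T ^^ t) (emb v) |t. t < k * degree p}" by simp
      also have "\<dots> \<subseteq> fs.span ?S" by (rule fs.span_mono) (use v(1) in \<open>auto simp: S\<close>)
      finally show ?thesis .
    qed
    then show ?case using step by (simp add: T_add T_sc fs.span_add fs.span_scale)
  qed
  have "subspace (fs.span ?S)"
  proof (rule subspaceI)
    show "pact T p f \<in> fs.span ?S" if "f \<in> fs.span ?S" for p f
      by (induction p) (auto simp: pact_pCons fs.span_zero intro!: fs.span_add fs.span_scale TS that)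
  qed (auto intro: fs.span_zero fs.span_add)
  moreover have "fst ` set (E ds) \<subseteq> fs.span ?S"
  proof clarsimp
    fix v p k' assume d: "(v, p, k') \<in> set ds"
    then have "0 < k' * degree p"
      using k monic_irred_degree_pos by (force simp: killed_def)
    then have "(T ^^ 0) (emb v) \<in> ?S" unfolding S using d by blast
    then show "emb v \<in> fs.span ?S" by (auto intro: fs.span_base)
  qed
  ultimately show "gen (E ds) \<subseteq> fs.span ?S" by (intro gen_subset)
qed

end

section \<open>Determinants and spans of columns\<close>

lemma mult_mat_vec_span:
  fixes vs :: "'a::field vec list"
  assumes vs: "set vs \<subseteq> carrier_vec m" "length vs = m"
  shows "(\<lambda>c. emb (mat_of_cols m vs *\<^sub>v c)) ` carrier_vec m = fs.span (emb ` set vs)"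
    (is "?f ` _ = _")
proof (intro subset_antisym)
  let ?M = "mat_of_cols m vs"
  have M: "?M \<in> carrier_mat m m" using vs(2) by (metis mat_of_cols_carrier(1))
  have f: "?f c = (\<Sum>j<m. sc (c $ j) (emb (vs ! j)))" if c: "c \<in> carrier_vec m" for c
  proof (rule poly_eqI)
    fix i
    have d: "dim_vec (vs ! j) = m" if "j < m" for j
      using vs that by (metis carrier_vecD nth_mem subsetD)
    show "coeff (?f c) i = coeff (\<Sum>j<m. sc (c $ j) (emb (vs ! j))) i"
    proof (cases "i < m")
      case True
      then have "coeff (?f c) i = (\<Sum>j<m. ?M $$ (i, j) * c $ j)"
        using c M by (auto simp: coeff_emb scalar_prod_def lessThan_atLeast0 intro!: sum.cong)
      also have "\<dots> = (\<Sum>j<m. c $ j * coeff (emb (vs ! j)) i)"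
        using True vs(2) d by (auto simp: mat_of_cols_index coeff_emb intro!: sum.cong)
      finally show ?thesis by (simp add: coeff_sum)
    next
      case False
      then show ?thesis using M d by (auto simp: coeff_sum coeff_emb intro!: sum.neutral)
    qed
  qed
  show "?f ` carrier_vec m \<subseteq> fs.span (emb ` set vs)"
  proof clarify
    fix c :: "'a vec" assume c: "c \<in> carrier_vec m"
    show "?f c \<in> fs.span (emb ` set vs)"
      unfolding f[OF c] using vs(2) by (intro fs.span_sum fs.span_scale fs.span_base) simp
  qed
  show "fs.span (emb ` set vs) \<subseteq> ?f ` carrier_vec m"
  proof (rule fs.span_minimal)
    show "emb ` set vs \<subseteq> ?f ` carrier_vec m"
    proof clarify
      fix v assume "v \<in> set vs"
      then obtain j where j: "j < m" "v = vs ! j" using vs(2) by (auto simp: in_set_conv_nth)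
      have "?f (unit_vec m j) = (\<Sum>i<m. sc (unit_vec m j $ i) (emb (vs ! i)))" by (rule f) simp
      also have "\<dots> = (\<Sum>i<m. if i = j then emb (vs ! i) else 0)"
        by (rule sum.cong) (use j(1) in auto)
      finally have "emb v = ?f (unit_vec m j)" using j by simp
      then show "emb v \<in> ?f ` carrier_vec m" by (rule image_eqI) simp
    qed
    show "fs.subspace (?f ` carrier_vec m)"
    proof (rule fs.subspaceI)
      have "?f (0\<^sub>v m) = 0" using M by (subst f) (auto intro!: sum.neutral)
      then show "0 \<in> ?f ` carrier_vec m" by (metis image_eqI zero_carrier_vec)
      show "g + h \<in> ?f ` carrier_vec m" if gh: "g \<in> ?f ` carrier_vec m" "h \<in> ?f ` carrier_vec m" for g h
      proof -
        obtain c d where cd: "c \<in> carrier_vec m" "d \<in> carrier_vec m" "g = ?f c" "h = ?f d" using gh by blast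
        have "g + h = ?f (c + d)"
          using cd M by (simp add: mult_add_distrib_mat_vec[OF M] emb_add[of _ m])
        then show ?thesis using cd(1,2) by (metis add_carrier_vec image_eqI)
      qed
      show "sc a g \<in> ?f ` carrier_vec m" if g: "g \<in> ?f ` carrier_vec m" for a g
      proof -
        obtain c where c: "c \<in> carrier_vec m" "g = ?f c" using g by blast
        have "sc a g = ?f (a \<cdot>\<^sub>v c)" using c M by (simp add: mult_mat_vec[OF M] emb_smult)
        then show ?thesis using c(1) by (metis smult_carrier_vec image_eqI)
      qed
    qed
  qed
qed

text \<open>A nonzero determinant means a trivial kernel, so injectivity; on a finite set this is
  surjectivity.\<close>

lemma det_nonzero_iff_surj:
  fixes M :: "'a::{finite,field} mat"
  assumes M: "M \<in> carrier_mat m m"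
  shows "det M \<noteq> 0 \<longleftrightarrow> (\<lambda>c. M *\<^sub>v c) ` carrier_vec m = carrier_vec m"
proof -
  have sub: "(\<lambda>c. M *\<^sub>v c) ` carrier_vec m \<subseteq> carrier_vec m" using M by auto
  have "det M \<noteq> 0 \<longleftrightarrow> inj_on (\<lambda>c. M *\<^sub>v c) (carrier_vec m)"
  proof
    assume d: "det M \<noteq> 0"
    show "inj_on (\<lambda>c. M *\<^sub>v c) (carrier_vec m)"
    proof (rule inj_onI)
      fix c d assume cd: "c \<in> carrier_vec m" "d \<in> carrier_vec m" "M *\<^sub>v c = M *\<^sub>v d"
      have "M *\<^sub>v (c - d) = M *\<^sub>v c - M *\<^sub>v d" using cd M by (simp add: mult_minus_distrib_mat_vec)
      also have "\<dots> = 0\<^sub>v m" using cd M by simp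
      finally have 0: "M *\<^sub>v (c - d) = 0\<^sub>v m" .
      have "c - d = 0\<^sub>v m"
      proof (rule ccontr)
        assume "c - d \<noteq> 0\<^sub>v m"
        then have "\<exists>v. v \<in> carrier_vec m \<and> v \<noteq> 0\<^sub>v m \<and> M *\<^sub>v v = 0\<^sub>v m"
          using 0 cd by (intro exI[of _ "c - d"]) simp
        then show False using d det_0_iff_vec_prod_zero_field[OF M] by simp
      qed
      then show "c = d" using cd by (auto simp: vec_eq_iff)
    qed
  next
    assume inj: "inj_on (\<lambda>c. M *\<^sub>v c) (carrier_vec m)"
    have "M *\<^sub>v 0\<^sub>v m = 0\<^sub>v m" using M by auto
    then have "v = 0\<^sub>v m" if "v \<in> carrier_vec m" "M *\<^sub>v v = 0\<^sub>v m" for v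
      using inj_onD[OF inj, of v "0\<^sub>v m"] that by simp
    then show "det M \<noteq> 0" using det_0_iff_vec_prod_zero_field[OF M] by blast
  qed
  also have "\<dots> \<longleftrightarrow> (\<lambda>c. M *\<^sub>v c) ` carrier_vec m = carrier_vec m"
    using finite_carrier_vec[where 'a='a, of m] sub endo_inj_surj eq_card_imp_inj_on by metis
  finally show ?thesis .
qed

lemma det_mat_of_cols_iff:
  fixes vs :: "'a::{finite,field} vec list"
  assumes vs: "set vs \<subseteq> carrier_vec m" "length vs = m"
  shows "det (mat_of_cols m vs) \<noteq> 0 \<longleftrightarrow> fs.span (emb ` set vs) = polys_below m"
proof -
  let ?M = "mat_of_cols m vs"
  have M: "?M \<in> carrier_mat m m" using vs(2) by (metis mat_of_cols_carrier(1))
  have "fs.span (emb ` set vs) = emb ` ((\<lambda>c. ?M *\<^sub>v c) ` carrier_vec m)"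
    using mult_mat_vec_span[OF vs] by (simp add: image_image)
  moreover have "emb ` X = polys_below m \<longleftrightarrow> X = carrier_vec m" if "X \<subseteq> carrier_vec m" for X :: "'a vec set"
  proof -
    have "inj_on emb (carrier_vec m :: 'a vec set)" by (auto simp: inj_on_def emb_inj)
    then show ?thesis using that inj_on_image_eq_iff[of emb "carrier_vec m" X "carrier_vec m"]
      by (simp add: emb_image)
  qed
  moreover have "(\<lambda>c. ?M *\<^sub>v c) ` carrier_vec m \<subseteq> carrier_vec m" using M by auto
  ultimately show ?thesis using det_nonzero_iff_surj[OF M] by metis
qed

lemma map_snd_apfst [simp]: "map snd (map (apfst f) ds) = map snd ds"
  by (induction ds) auto

lemma wt_mset_cong: "mset L = mset L' \<Longrightarrow> wt L = wt L'"
  unfolding wt_def by (simp flip: sum_mset_sum_list)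

lemma minsum_mset_cong: "mset L = mset L' \<Longrightarrow> minsum p j L = minsum p j L'"
  unfolding minsum_def by (simp flip: sum_mset_sum_list)

lemma family_count_cong:
  "(\<And>p k j. (p, k) \<in> set L \<Longrightarrow> K p j = K' p j) \<Longrightarrow> family_count K L = family_count K' L"
proof (induction L)
  case (Cons d L)
  obtain p k where d: "d = (p, k)" by (cases d)
  have "family_count K L = family_count K' L" by (rule Cons.IH) (rule Cons.prems, erule list.set_intros(2))
  moreover have "K p j = K' p j" for j by (rule Cons.prems[of p k]) (simp add: d)
  ultimately show ?case by (simp add: d)
qed simp

lemma (in poly_module) indep_top_nonzero:
  "indep ds \<Longrightarrow> (v, p, k) \<in> set ds \<Longrightarrow> p ^ (k - 1) *s v \<noteq> 0"
proof (induction ds rule: indep.induct)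
  case (2 v' p' k' ds)
  then show ?case using subspace_0[OF subspace_gen, of ds] by auto
qed simp

section \<open>Cyclic decompositions of one matrix: existence, unique shape, number\<close>

context mat_action
begin

lemma cyc_vectors_carrier:
  assumes "fst ` set ds \<subseteq> carrier_vec m"
  shows "set (cyc_vectors x ds) \<subseteq> carrier_vec m"
  unfolding set_cyc_vectors using assms mult_mat_vec_carrier[OF pow_carrier] by force

lemma cyclic_decomp_carrier: "cyclic_decomp m x ds \<Longrightarrow> fst ` set ds \<subseteq> carrier_vec m"
  by (auto simp: cyclic_decomp_def)

lemma cyclic_decomp_iff:
  "cyclic_decomp m x ds \<longleftrightarrow> fst ` set ds \<subseteq> carrier_vec m \<and> killed (E ds) \<and>
    wt (map snd ds) = m \<and> gen (E ds) = polys_below m"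
proof (cases "fst ` set ds \<subseteq> carrier_vec m")
  case True
  have "det (mat_of_cols m (cyc_vectors x ds)) \<noteq> 0 \<longleftrightarrow> gen (E ds) = polys_below m"
    if "killed (E ds)" "wt (map snd ds) = m"
    using det_mat_of_cols_iff[OF cyc_vectors_carrier[OF True]] gen_E_eq_span[OF True] that
    by (simp add: length_cyc_vectors)
  moreover have "cyclic_decomp m x ds \<longleftrightarrow> killed (E ds) \<and> wt (map snd ds) = m \<and>
      det (mat_of_cols m (cyc_vectors x ds)) \<noteq> 0"
    unfolding cyclic_decomp_def killed_E_iff[OF True] length_cyc_vectors using True by fastforce
  ultimately show ?thesis using True by blast
next
  case False
  then show ?thesis unfolding cyclic_decomp_def by fastforce
qed

text \<open>Killed generators of total weight \<open>m\<close> whose span has \<open>q ^ m\<close>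
  elements are independent; conversely, independence fixes the weight by the size of the
  span.\<close>

lemma cyclic_decomp_iff_indep:
  "cyclic_decomp m x ds \<longleftrightarrow> fst ` set ds \<subseteq> carrier_vec m \<and> indep (E ds) \<and> gen (E ds) = polys_below m"
proof
  assume d: "cyclic_decomp m x ds"
  then have "indep (E ds)"
    by (intro killed_card_gen(3)) (auto simp: cyclic_decomp_iff polys_below_card simp del: map_map)
  then show "fst ` set ds \<subseteq> carrier_vec m \<and> indep (E ds) \<and> gen (E ds) = polys_below m"
    using d by (simp add: cyclic_decomp_iff)
next
  assume d: "fst ` set ds \<subseteq> carrier_vec m \<and> indep (E ds) \<and> gen (E ds) = polys_below m"
  have "CARD('a) ^ wt (map snd ds) = CARD('a) ^ m"
    using indep_card_gen(2)[of "E ds"] d by (simp add: polys_below_card del: map_map)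
  then have "wt (map snd ds) = m" using two_le_card by simp
  then show "cyclic_decomp m x ds" using d indep_killed by (simp add: cyclic_decomp_iff)
qed

lemma E_vec:
  assumes "fst ` set es \<subseteq> polys_below m"
  shows "E (map (apfst (\<lambda>f. vec m (coeff f))) es) = es"
  using assms by (induction es) (auto simp: emb_vec)

lemma cyclic_decomp_exists: "\<exists>ds. cyclic_decomp m x ds"
proof -
  obtain es where es: "indep es" "fst ` set es \<subseteq> polys_below m" "gen es = polys_below m"
    using cyclic_family_exists[OF subspace_below polys_below_card(1)] by blast
  have "cyclic_decomp m x (map (apfst (\<lambda>f. vec m (coeff f))) es)"
    unfolding cyclic_decomp_iff_indep E_vec[OF es(2)] using es by auto
  then show ?thesis ..
qed

lemma cyclic_decomp_entries:
  "cyclic_decomp m x ds \<Longrightarrow> \<forall>(p, k)\<in>set (map snd ds). monic_irred p \<and> 1 \<le> k"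
  unfolding cyclic_decomp_def by auto

lemma cyclic_decomp_kernel_card:
  assumes "cyclic_decomp m x ds" "monic_irred P"
  shows "kernel_card (polys_below m) P j = CARD('a) ^ (degree P * minsum P j (map snd ds))"
  using indep_card_kernel[of "E ds" P j] assms
  by (simp add: cyclic_decomp_iff_indep kernel_card_def del: map_map)

text \<open>Both decompositions compute the same kernel sizes, which determine \<open>minsum\<close>
  and with it the partitions. This makes the choice by \<open>SOME\<close> in
  \<open>rcf_data\<close> harmless.\<close>

lemma cyclic_decomp_unique:
  assumes "cyclic_decomp m x ds" "cyclic_decomp m x ds'"
  shows "shape_data (map snd ds) = shape_data (map snd ds')"
proof
  fix p
  note e = cyclic_decomp_entries[OF assms(1)] cyclic_decomp_entries[OF assms(2)]
  show "shape_data (map snd ds) p = shape_data (map snd ds') p"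
  proof (cases "monic_irred p")
    case True
    have "minsum p j (map snd ds) = minsum p j (map snd ds')" for j
    proof -
      have "CARD('a) ^ (degree p * minsum p j (map snd ds)) = CARD('a) ^ (degree p * minsum p j (map snd ds'))"
        using cyclic_decomp_kernel_card[OF _ True] assms by metis
      then show ?thesis using two_le_card monic_irred_degree_pos[OF True] by simp
    qed
    then show ?thesis using e by (intro shape_data_eqI) auto
  next
    case False
    then have "shape_data (map snd ds) p = {#}" "shape_data (map snd ds') p = {#}"
      unfolding shape_data_empty_iff using e by auto
    then show ?thesis by simp
  qed
qed

lemma rcf_data_eq:
  assumes "cyclic_decomp m x ds"
  shows "rcf_data m x = shape_data (map snd ds)"
proof -
  have data: "(\<lambda>p. mset (map (\<lambda>(v, p', k). k) (filter (\<lambda>(v, p', k). p' = p) es))) = shape_data (map snd es)"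
    for es :: "('a vec \<times> 'a poly \<times> nat) list"
    by (intro ext, induction es) auto
  have "rcf_data m x = shape_data (map snd (SOME ds. cyclic_decomp m x ds))"
    unfolding rcf_data_def Let_def data ..
  then show ?thesis using cyclic_decomp_unique[OF someI[of "cyclic_decomp m x"]] assms by metis
qed

text \<open>\<open>killed\<close>, \<open>gen\<close> and \<open>wt\<close> visibly ignore the order
  of the list, so a decomposition may be sorted; for \<open>indep\<close> this cannot be read off
  its definition.\<close>

lemma sorted_cyclic_decomp_exists:
  obtains ds where "cyclic_decomp m x ds" "sorted (map snd (map snd ds))"
proof -
  obtain ds0 where ds0: "cyclic_decomp m x ds0" using cyclic_decomp_exists by blast
  let ?ds = "sort_key (\<lambda>d. snd (snd d)) ds0"
  have "wt (map snd ?ds) = wt (map snd ds0)" by (intro wt_mset_cong) simp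
  then have "cyclic_decomp m x ?ds"
    using ds0 unfolding cyclic_decomp_iff killed_def gen_def by simp
  moreover have "sorted (map snd (map snd ?ds))" by (simp add: comp_def)
  ultimately show ?thesis using that by blast
qed

text \<open>Decompositions with order list \<open>L\<close> are the independent families with that
  list. The kernel sizes in the count come from \<open>ds0\<close>, whose orders are
  \<open>L\<close> up to permutation.\<close>

lemma card_cyclic_decomps:
  assumes ds0: "cyclic_decomp m x ds0" and L: "mset (map snd ds0) = mset L" "sorted (map snd L)"
  shows "finite {ds. cyclic_decomp m x ds \<and> map snd ds = L}"
    "real (card {ds. cyclic_decomp m x ds \<and> map snd ds = L})
      = family_count (\<lambda>p k. CARD('a) ^ (degree p * minsum p k L)) L"
proof -
  let ?D = "{ds. cyclic_decomp m x ds \<and> map snd ds = L}"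
  have setL: "set L = set (map snd ds0)" using L(1) by (metis set_mset_mset)
  have e: "\<forall>(p, k)\<in>set L. monic_irred p \<and> 1 \<le> k" using cyclic_decomp_entries[OF ds0] setL by simp
  have wL: "wt L = m" using ds0 wt_mset_cong[OF L(1)] by (simp add: cyclic_decomp_iff)
  have bij: "bij_betw E ?D (families (polys_below m) L)"
  proof (rule bij_betw_byWitness[where f' = "map (apfst (\<lambda>f. vec m (coeff f)))"])
    have "map (apfst (\<lambda>f. vec m (coeff f))) (E ds) = ds" if "fst ` set ds \<subseteq> carrier_vec m" for ds
      using that by (induction ds) (auto simp: vec_emb)
    then show "\<forall>ds\<in>?D. map (apfst (\<lambda>f. vec m (coeff f))) (E ds) = ds"
      by (simp add: cyclic_decomp_iff del: map_map)
    show "\<forall>es\<in>families (polys_below m) L. E (map (apfst (\<lambda>f. vec m (coeff f))) es) = es"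
      using E_vec by (simp add: families_def del: map_map)
    have "E ds \<in> families (polys_below m) L" if ds: "ds \<in> ?D" for ds
    proof -
      have "fst ` set (E ds) = emb ` fst ` set ds" by (force simp: image_image)
      moreover have "fst ` set ds \<subseteq> carrier_vec m" using ds by (simp add: cyclic_decomp_iff)
      ultimately have "fst ` set (E ds) \<subseteq> polys_below m" using emb_image by fast
      then show ?thesis using ds by (simp add: families_def cyclic_decomp_iff_indep del: map_map)
    qed
    then show "E ` ?D \<subseteq> families (polys_below m) L" by blast
    have "map (apfst (\<lambda>f. vec m (coeff f))) es \<in> ?D" if es: "es \<in> families (polys_below m) L" for es
    proof -
      have i: "indep es" "fst ` set es \<subseteq> polys_below m" "map snd es = L"
        using es unfolding families_def by simp_all
      have "gen es \<subseteq> polys_below m" using gen_subset[OF subspace_below i(2)] .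
      \<comment> \<open>Generation is a matter of size: the span has \<open>q ^ wt L = q ^ m\<close>
        elements.\<close>
      moreover have "card (gen es) = card (polys_below m :: 'a poly set)"
        using indep_card_gen(2)[OF i(1)] i(3) wL by (simp add: polys_below_card)
      ultimately have "gen es = polys_below m" using card_subset_eq[OF polys_below_card(1)] by blast
      then show ?thesis using i by (auto simp: cyclic_decomp_iff_indep E_vec simp del: map_map)
    qed
    then show "map (apfst (\<lambda>f. vec m (coeff f))) ` families (polys_below m) L \<subseteq> ?D" by blast
  qed
  have "family_count (kernel_card (polys_below m)) L
      = family_count (\<lambda>p k. CARD('a) ^ (degree p * minsum p k L)) L"
    using cyclic_decomp_kernel_card[OF ds0] e minsum_mset_cong[OF L(1)]
    by (intro family_count_cong) auto
  then show "finite ?D" "real (card ?D) = family_count (\<lambda>p k. CARD('a) ^ (degree p * minsum p k L)) L"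
    using card_families[OF subspace_below polys_below_card(1) L(2) e]
      bij_betw_finite[OF bij] bij_betw_same_card[OF bij] by simp_all
qed

text \<open>A summand for \<open>z\<close> contains the nonzero vector \<open>z ^ (k - 1) v\<close>,
  which \<open>x\<close> sends to 0.\<close>

lemma det_nonzero_imp_no_z:
  assumes d: "cyclic_decomp m x ds" "det x \<noteq> 0" "(v, p, k) \<in> set ds"
  shows "p \<noteq> [:0, 1:]"
proof
  assume z: "p = [:0, 1:]"
  have i: "indep (E ds)" "(emb v, p, k) \<in> set (E ds)" using d by (force simp: cyclic_decomp_iff_indep)+
  have k: "1 \<le> k" and kill: "pact T (p ^ k) (emb v) = 0"
    using indep_killed[OF i(1)] i(2) unfolding killed_def by auto
  have v: "v \<in> carrier_vec m" using d by (auto simp: cyclic_decomp_def)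
  define w where "w = poly_act x (p ^ (k - 1)) v"
  have w: "w \<in> carrier_vec m" unfolding w_def by (rule poly_act_carrier[OF v])
  have ew: "emb w = pact T (p ^ (k - 1)) (emb v)" unfolding w_def by (rule emb_poly_act[OF v])
  then have "emb w \<noteq> 0" using indep_top_nonzero[OF i] by simp
  then have "w \<noteq> 0\<^sub>v m" using emb_zero by auto
  moreover have "x *\<^sub>v w = 0\<^sub>v m"
  proof -
    have "emb (x *\<^sub>v w) = pact T p (emb w)" by (simp add: z pact_pCons T_0 T_emb[OF w])
    also have "\<dots> = pact T (p * p ^ (k - 1)) (emb v)" unfolding ew by simp
    also have "p * p ^ (k - 1) = p ^ k" using k by (cases k) auto
    finally show ?thesis using kill emb_inj[of "x *\<^sub>v w" m "0\<^sub>v m"] x w by (simp add: emb_zero)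
  qed
  ultimately show False using det_0_iff_vec_prod_zero_field[OF x] d(2) w by blast
qed

text \<open>The eigenspace is the kernel of \<open>z - a\<close>, and at level 1
  \<open>minsum\<close> is the number of parts.\<close>

lemma card_eigenspace:
  "card {v \<in> carrier_vec m. x *\<^sub>v v = a \<cdot>\<^sub>v v} = CARD('a) ^ part_conj (rcf_data m x [:- a, 1:]) 1"
proof -
  obtain ds where ds: "cyclic_decomp m x ds" using cyclic_decomp_exists by blast
  have irr: "monic_irred [:- a, 1:]"
    by (simp add: monic_irred_def irreducible_linear_field_poly)
  let ?K = "{u \<in> polys_below m. pact T ([:- a, 1:] ^ 1) u = 0}"
  let ?F = "{v \<in> carrier_vec m. x *\<^sub>v v = a \<cdot>\<^sub>v v}"
  have "pact T ([:- a, 1:] ^ 1) (emb v) = 0 \<longleftrightarrow> x *\<^sub>v v = a \<cdot>\<^sub>v v" if v: "v \<in> carrier_vec m" for v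
    using emb_inj[of "x *\<^sub>v v" m "a \<cdot>\<^sub>v v"] v x by (simp add: pact_linear T_emb emb_smult)
  then have "emb ` ?F = ?K"
    unfolding emb_image[symmetric] by auto
  moreover have "inj_on emb ?F" using emb_inj by (auto simp: inj_on_def)
  then have "card (emb ` ?F) = card ?F" by (rule card_image)
  ultimately have "card ?F = card ?K" by simp
  also have "\<dots> = CARD('a) ^ minsum [:- a, 1:] 1 (map snd ds)"
    using cyclic_decomp_kernel_card[OF ds irr, of 1] by (simp add: kernel_card_def)
  also have "minsum [:- a, 1:] 1 (map snd ds) = part_conj (rcf_data m x [:- a, 1:]) 1"
    unfolding rcf_data_eq[OF ds] by (simp add: minsum_part_conj)
  finally show ?thesis .
qed

end

section \<open>Conjugation\<close>

definition inv_pair :: "nat \<Rightarrow> 'a::field mat \<Rightarrow> 'a mat \<Rightarrow> bool" where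
  "inv_pair m h g \<longleftrightarrow> h \<in> carrier_mat m m \<and> g \<in> carrier_mat m m \<and> h * g = 1\<^sub>m m \<and> g * h = 1\<^sub>m m"

lemma inv_pair_sym: "inv_pair m h g \<Longrightarrow> inv_pair m g h"
  by (simp add: inv_pair_def)

lemma inv_pair_GL: "inv_pair m h g \<Longrightarrow> h \<in> GL m"
  unfolding inv_pair_def GL_def using det_mult[of h m g] by auto

lemma GL_inv_pair:
  assumes "h \<in> GL m"
  obtains g where "inv_pair m h g"
proof -
  have "h \<in> carrier_mat m m" "det h \<noteq> 0" using assms by (auto simp: GL_def)
  from det_non_zero_imp_unit[OF this, of "()"]
  show ?thesis using that unfolding Units_def ring_mat_def inv_pair_def by auto
qed

lemma GL_carrier: "h \<in> GL m \<Longrightarrow> h \<in> carrier_mat m m"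
  by (simp add: GL_def)

lemma GL_mult: "h \<in> GL m \<Longrightarrow> g \<in> GL m \<Longrightarrow> h * g \<in> GL m"
  unfolding GL_def by (auto simp: det_mult[of _ m])

lemma inv_pair_vec:
  assumes "inv_pair m h g" "v \<in> carrier_vec m"
  shows "g *\<^sub>v (h *\<^sub>v v) = v"
  using assms assoc_mult_mat_vec[of g m m h m v] by (simp add: inv_pair_def)

lemma inv_pair_cancel_left:
  assumes hg: "inv_pair m h g" and x: "x \<in> carrier_mat m m"
  shows "g * (h * x) = x"
  using hg x assoc_mult_mat[of g m m h m x m] by (simp add: inv_pair_def)

lemma inv_pair_cancel_right:
  assumes hg: "inv_pair m h g" and x: "x \<in> carrier_mat m m"
  shows "(x * h) * g = x"
  using hg x assoc_mult_mat[of x m m h m g m] by (simp add: inv_pair_def)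

lemma conj_intertwines:
  assumes hg: "inv_pair m h g" and x: "x \<in> carrier_mat m m"
  shows "(h * x * g) * h = h * x"
proof -
  have "h * x \<in> carrier_mat m m" using hg x by (intro mult_carrier_mat[of _ m m]) (auto simp: inv_pair_def)
  then show ?thesis by (rule inv_pair_cancel_right[OF inv_pair_sym[OF hg]])
qed

lemma intertwine_conj:
  assumes hg: "inv_pair m h g" and xy: "x \<in> carrier_mat m m" "y \<in> carrier_mat m m" "y * h = h * x"
  shows "h * x * g = y"
  using inv_pair_cancel_right[OF hg xy(2)] xy(3) by simp

lemma finite_GL: "finite (GL m :: 'a::{finite,field} mat set)"
proof (rule finite_subset)
  show "GL m \<subseteq> (mat_of_cols m :: 'a vec list \<Rightarrow> _) ` {vs. set vs \<subseteq> carrier_vec m \<and> length vs = m}"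
  proof
    fix h :: "'a mat" assume h: "h \<in> GL m"
    then have "dim_row h = m" by (auto simp: GL_def)
    then have "h = mat_of_cols m (cols h)" using mat_of_cols_cols[of h] by (simp only:)
    moreover have "set (cols h) \<subseteq> carrier_vec m" "length (cols h) = m"
      using h cols_dim[of h] carrier_matD[of h m m] by (auto simp: GL_def simp del: cols_dim)
    ultimately show "h \<in> mat_of_cols m ` {vs. set vs \<subseteq> carrier_vec m \<and> length vs = m}"
      by (intro image_eqI[of _ _ "cols h"]) auto
  qed
  show "finite ((mat_of_cols m :: 'a vec list \<Rightarrow> _) ` {vs. set vs \<subseteq> carrier_vec m \<and> length vs = m})"
    by (intro finite_imageI finite_lists_length_eq finite_carrier_vec)
qed

lemma mat_of_cols_mult:
  assumes h: "h \<in> carrier_mat m m" and vs: "set vs \<subseteq> carrier_vec m"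
  shows "mat_of_cols m (map ((*\<^sub>v) h) vs) = h * mat_of_cols m vs"
proof (rule eq_matI)
  fix i j assume "i < dim_row (h * mat_of_cols m vs)" "j < dim_col (h * mat_of_cols m vs)"
  then have ij: "i < m" "j < length vs" using h by auto
  have "vs ! j \<in> carrier_vec m" using ij(2) vs by auto
  then show "mat_of_cols m (map ((*\<^sub>v) h) vs) $$ (i, j) = (h * mat_of_cols m vs) $$ (i, j)"
    using ij h by (simp add: mat_of_cols_index)
qed (use h in auto)

lemma cyc_vectors_Nil [simp]: "cyc_vectors x [] = []"
  and cyc_vectors_Cons [simp]: "cyc_vectors x ((v, p, k) # ds) =
    map (\<lambda>t. x ^\<^sub>m t *\<^sub>v v) [0..<k * degree p] @ cyc_vectors x ds"
  by (simp_all add: cyc_vectors_def)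

text \<open>The relation makes \<open>h\<close> a module map from the action of \<open>x\<close> to
  that of \<open>y\<close>, so everything built from powers of the matrix is carried along by
  \<open>h\<close>.\<close>

locale intertwining =
  X: mat_action m x + Y: mat_action m y + H: mat_action m h
  for m :: nat and x y h :: "'a::{finite,field} mat" +
  assumes yh: "y * h = h * x"
begin

lemma power_vec:
  assumes "v \<in> carrier_vec m"
  shows "y ^\<^sub>m t *\<^sub>v (h *\<^sub>v v) = h *\<^sub>v (x ^\<^sub>m t *\<^sub>v v)"
proof -
  have "y ^\<^sub>m t * h = h * x ^\<^sub>m t"
  proof (induction t)
    case (Suc t)
    have "y ^\<^sub>m Suc t * h = y ^\<^sub>m t * (y * h)"
      using assoc_mult_mat[OF Y.pow_carrier Y.x H.x] by simp
    also have "\<dots> = (y ^\<^sub>m t * h) * x"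
      unfolding yh using assoc_mult_mat[OF Y.pow_carrier H.x X.x] by simp
    also have "\<dots> = h * x ^\<^sub>m Suc t"
      unfolding Suc using assoc_mult_mat[OF H.x X.pow_carrier X.x] by simp
    finally show ?case .
  qed (use X.x Y.x H.x in simp)
  then show ?thesis
    using assoc_mult_mat_vec[OF Y.pow_carrier H.x assms] assoc_mult_mat_vec[OF H.x X.pow_carrier assms]
    by metis
qed

lemma endo_commute: "H.T (X.T f) = Y.T (H.T f)"
proof -
  let ?v = "vec m (coeff f)"
  have v: "?v \<in> carrier_vec m" by simp
  have "H.T (X.T f) = emb (h *\<^sub>v (x *\<^sub>v ?v))"
    unfolding mat_endo_def[of m x] using X.x by (intro H.T_emb) simp
  also have "h *\<^sub>v (x *\<^sub>v ?v) = y *\<^sub>v (h *\<^sub>v ?v)"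
    using assoc_mult_mat_vec[OF Y.x H.x v] assoc_mult_mat_vec[OF H.x X.x v] yh by simp
  also have "emb \<dots> = Y.T (H.T f)"
    unfolding mat_endo_def[of m h] using H.x by (intro Y.T_emb[symmetric]) simp
  finally show ?thesis .
qed

lemma poly_act_vec:
  assumes v: "v \<in> carrier_vec m"
  shows "poly_act y p (h *\<^sub>v v) = h *\<^sub>v poly_act x p v"
proof -
  have "H.T (pact X.T p f) = pact Y.T p (H.T f)" for f
    by (induction p) (simp_all add: X.pact_pCons Y.pact_pCons H.T_add H.T_sc H.T_0 endo_commute)
  then have "emb (h *\<^sub>v poly_act x p v) = emb (poly_act y p (h *\<^sub>v v))"
    using v H.x by (simp add: X.poly_act_carrier Y.emb_poly_act X.emb_poly_act flip: H.T_emb)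
  moreover have "h *\<^sub>v poly_act x p v \<in> carrier_vec m" "poly_act y p (h *\<^sub>v v) \<in> carrier_vec m"
    using v H.x X.poly_act_carrier Y.poly_act_carrier by auto
  ultimately show ?thesis using emb_inj by metis
qed

lemma cyc_vectors_map:
  assumes "fst ` set ds \<subseteq> carrier_vec m"
  shows "cyc_vectors y (map (apfst ((*\<^sub>v) h)) ds) = map ((*\<^sub>v) h) (cyc_vectors x ds)"
  using assms by (induction ds) (auto simp: power_vec)

lemma cyclic_decomp_map:
  assumes d: "cyclic_decomp m x ds" and h: "det h \<noteq> 0"
  shows "cyclic_decomp m y (map (apfst ((*\<^sub>v) h)) ds)"
proof -
  note c = X.cyclic_decomp_carrier[OF d]
  have "v \<in> carrier_vec m" "poly_act y (p ^ k) (h *\<^sub>v v) = 0\<^sub>v m" if "(v, p, k) \<in> set ds" for v p k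
  proof -
    show v: "v \<in> carrier_vec m" using c that by force
    have "poly_act x (p ^ k) v = 0\<^sub>v m" using d that by (auto simp: cyclic_decomp_def)
    then show "poly_act y (p ^ k) (h *\<^sub>v v) = 0\<^sub>v m" using poly_act_vec[OF v] H.x by auto
  qed
  moreover note cyc = X.cyc_vectors_carrier[OF c]
  moreover have "mat_of_cols m (cyc_vectors x ds) \<in> carrier_mat m m"
    using d mat_of_cols_carrier(1)[of m "cyc_vectors x ds"] by (simp add: cyclic_decomp_def)
  ultimately show ?thesis
    using d h H.x unfolding cyclic_decomp_def cyc_vectors_map[OF c] mat_of_cols_mult[OF H.x cyc]
    by (auto simp: det_mult[OF H.x])
qed

end

lemma rcf_data_conj:
  fixes x :: "'a::{finite,field} mat"
  assumes hg: "inv_pair m h g" and x: "x \<in> carrier_mat m m"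
  shows "rcf_data m (h * x * g) = rcf_data m x"
proof -
  have c: "h \<in> carrier_mat m m" "h * x * g \<in> carrier_mat m m" using hg x by (auto simp: inv_pair_def)
  interpret intertwining m x "h * x * g" h
    by unfold_locales (use c x conj_intertwines[OF hg x] in auto)
  obtain ds where ds: "cyclic_decomp m x ds" using X.cyclic_decomp_exists by blast
  have "det h \<noteq> 0" using inv_pair_GL[OF hg] by (simp add: GL_def)
  then have "cyclic_decomp m (h * x * g) (map (apfst ((*\<^sub>v) h)) ds)"
    using cyclic_decomp_map[OF ds] by simp
  then show ?thesis using X.rcf_data_eq[OF ds] Y.rcf_data_eq by (simp del: map_map)
qed

section \<open>Equal order lists give conjugate matrices\<close>

lemma cyc_vectors_match:
  fixes h :: "'a::field mat"
  assumes "map snd ds = map snd ds'" "cyc_vectors y ds' = map ((*\<^sub>v) h) (cyc_vectors x ds)"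
  shows "list_all2 (\<lambda>(u, p, k) (v, p', k'). p' = p \<and> k' = k \<and>
    (\<forall>t<k * degree p. y ^\<^sub>m t *\<^sub>v v = h *\<^sub>v (x ^\<^sub>m t *\<^sub>v u))) ds ds'"
proof -
  have "length ds = length ds'" using assms(1) by (metis length_map)
  then show ?thesis using assms
  proof (induction ds ds' rule: list_induct2)
    case (Cons d ds d' ds')
    obtain u p k where d: "d = (u, p, k)" by (cases d)
    obtain v where d': "d' = (v, p, k)" using Cons.prems(1) d by (cases d') auto
    \<comment> \<open>Both blocks have length \<open>k * degree p\<close>, so the equation of the
      concatenations splits at the same place.\<close>
    have "map (\<lambda>t. y ^\<^sub>m t *\<^sub>v v) [0..<k * degree p] = map (\<lambda>t. h *\<^sub>v (x ^\<^sub>m t *\<^sub>v u)) [0..<k * degree p] \<and>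
        cyc_vectors y ds' = map ((*\<^sub>v) h) (cyc_vectors x ds)"
      using Cons.prems(2) by (simp add: d d' comp_def)
    then have "\<forall>t<k * degree p. y ^\<^sub>m t *\<^sub>v v = h *\<^sub>v (x ^\<^sub>m t *\<^sub>v u)"
      "cyc_vectors y ds' = map ((*\<^sub>v) h) (cyc_vectors x ds)" by auto
    then show ?case using Cons by (simp add: d d')
  qed simp
qed

text \<open>Both top powers are the same combination of lower powers, with coefficients from
  \<open>p ^ k\<close>. This covers the exponent that the bases do not list but that arises when the
  last vector of a block is multiplied by the matrix.\<close>

lemma match_top:
  fixes x y h :: "'a::{finite,field} mat"
  assumes "x \<in> carrier_mat m m" "y \<in> carrier_mat m m" "h \<in> carrier_mat m m"
    and uv: "u \<in> carrier_vec m" "v \<in> carrier_vec m" and p: "monic_irred p"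
    and kill: "poly_act x (p ^ k) u = 0\<^sub>v m" "poly_act y (p ^ k) v = 0\<^sub>v m"
    and match: "\<And>t. t < k * degree p \<Longrightarrow> y ^\<^sub>m t *\<^sub>v v = h *\<^sub>v (x ^\<^sub>m t *\<^sub>v u)"
  shows "y ^\<^sub>m (k * degree p) *\<^sub>v v = h *\<^sub>v (x ^\<^sub>m (k * degree p) *\<^sub>v u)"
proof -
  interpret X: mat_action m x by unfold_locales (fact assms(1))
  interpret Y: mat_action m y by unfold_locales (fact assms(2))
  interpret H: mat_action m h by unfold_locales (fact assms(3))
  let ?d = "k * degree p"
  have c: "x ^\<^sub>m t *\<^sub>v u \<in> carrier_vec m" for t using X.pow_carrier uv(1) by (rule mult_mat_vec_carrier)
  have H: "H.T ((X.T ^^ t) (emb u)) = emb (h *\<^sub>v (x ^\<^sub>m t *\<^sub>v u))" for t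
    by (simp add: X.T_power_emb[OF uv(1)] H.T_emb[OF c])
  have kX: "pact X.T (p ^ k) (emb u) = 0" and kY: "pact Y.T (p ^ k) (emb v) = 0"
    using X.emb_poly_act[OF uv(1), of "p ^ k"] Y.emb_poly_act[OF uv(2), of "p ^ k"] kill
    by (simp_all add: emb_zero)
  have neg: "H.T (- f) = - H.T f" for f using H.T_sc[of "-1" f] by simp
  have "emb (h *\<^sub>v (x ^\<^sub>m ?d *\<^sub>v u)) = - (\<Sum>i<?d. sc (coeff (p ^ k) i) (H.T ((X.T ^^ i) (emb u))))"
    unfolding H[symmetric] X.top_power_eq[OF p kX] by (simp add: neg H.T_sum H.T_sc)
  also have "\<dots> = - (\<Sum>i<?d. sc (coeff (p ^ k) i) ((Y.T ^^ i) (emb v)))"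
    using match by (simp add: H Y.T_power_emb[OF uv(2)])
  also have "\<dots> = emb (y ^\<^sub>m ?d *\<^sub>v v)"
    unfolding Y.top_power_eq[OF p kY, symmetric] by (rule Y.T_power_emb[OF uv(2)])
  finally show ?thesis
    using emb_inj[of "h *\<^sub>v (x ^\<^sub>m ?d *\<^sub>v u)" m "y ^\<^sub>m ?d *\<^sub>v v"] c assms(3)
      mult_mat_vec_carrier[OF Y.pow_carrier uv(2)] by simp
qed

text \<open>\<open>h\<close> sends the cyclic basis of \<open>x\<close> to that of \<open>y\<close>
  in order. On a basis vector \<open>x ^ t u\<close> both \<open>y h\<close> and \<open>h x\<close>
  give \<open>y ^ (t + 1) v\<close>, at the end of a block by \<open>match_top\<close>, so they
  agree.\<close>

lemma decomps_same_shape_conjugate: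
  fixes x y :: "'a::{finite,field} mat"
  assumes x: "x \<in> carrier_mat m m" and y: "y \<in> carrier_mat m m"
    and ds: "cyclic_decomp m x ds" and ds': "cyclic_decomp m y ds'" and shape: "map snd ds = map snd ds'"
  obtains h where "h \<in> GL m" "y * h = h * x" "ds' = map (apfst ((*\<^sub>v) h)) ds"
proof -
  interpret X: mat_action m x by unfold_locales (fact x)
  interpret Y: mat_action m y by unfold_locales (fact y)
  let ?vs = "cyc_vectors x ds" and ?ws = "cyc_vectors y ds'"
  define G where "G = mat_of_cols m ?vs"
  define G' where "G' = mat_of_cols m ?ws"
  have len: "length ?vs = m" "length ?ws = m" and dets: "det G \<noteq> 0" "det G' \<noteq> 0"
    using ds ds' by (auto simp: cyclic_decomp_def G_def G'_def)
  note carr = X.cyclic_decomp_carrier[OF ds] Y.cyclic_decomp_carrier[OF ds']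
  note vs = X.cyc_vectors_carrier[OF carr(1)] Y.cyc_vectors_carrier[OF carr(2)]
  have G: "G \<in> carrier_mat m m" "G' \<in> carrier_mat m m"
    using len mat_of_cols_carrier(1)[of m ?vs] mat_of_cols_carrier(1)[of m ?ws] by (auto simp: G_def G'_def)
  then have GL: "G \<in> GL m" "G' \<in> GL m" using dets by (auto simp: GL_def)
  obtain Gi where Gi: "inv_pair m G Gi" using GL_inv_pair[OF GL(1)] .
  \<comment> \<open>Base change: \<open>h\<close> takes the columns of \<open>G\<close> to those of
    \<open>G'\<close>.\<close>
  define h where "h = G' * Gi"
  have hGL: "h \<in> GL m" unfolding h_def
    using GL(2) inv_pair_GL[OF inv_pair_sym[OF Gi]] by (rule GL_mult)
  note h = GL_carrier[OF hGL]
  have "h * G = G'" unfolding h_def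
    using inv_pair_cancel_right[OF inv_pair_sym[OF Gi] G(2)] .
  then have "mat_of_cols m (map ((*\<^sub>v) h) ?vs) = mat_of_cols m ?ws"
    using mat_of_cols_mult[OF h vs(1)] by (simp add: G_def G'_def)
  moreover have "set (map ((*\<^sub>v) h) ?vs) \<subseteq> carrier_vec m"
    using vs(1) mult_mat_vec_carrier[OF h] by auto
  ultimately have "?ws = map ((*\<^sub>v) h) ?vs" using cols_mat_of_cols vs(2) by metis
  from cyc_vectors_match[OF shape this]
  have la: "list_all2 (\<lambda>(u, p, k) (v, p', k'). p' = p \<and> k' = k \<and>
    (\<forall>t<k * degree p. y ^\<^sub>m t *\<^sub>v v = h *\<^sub>v (x ^\<^sub>m t *\<^sub>v u))) ds ds'" .
  have ex: "\<exists>v. (v, p, k) \<in> set ds' \<and> (\<forall>t<k * degree p. y ^\<^sub>m t *\<^sub>v v = h *\<^sub>v (x ^\<^sub>m t *\<^sub>v u))"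
    if uin: "(u, p, k) \<in> set ds" for u p k
  proof -
    obtain i where i: "i < length ds" "ds ! i = (u, p, k)" using uin by (auto simp: in_set_conv_nth)
    obtain v p' k' where v: "ds' ! i = (v, p', k')" by (cases "ds' ! i")
    have "i < length ds'" using i(1) la by (simp add: list_all2_lengthD)
    moreover have "p' = p \<and> k' = k \<and> (\<forall>t<k * degree p. y ^\<^sub>m t *\<^sub>v v = h *\<^sub>v (x ^\<^sub>m t *\<^sub>v u))"
      using list_all2_nthD[OF la i(1)] i(2) v by simp
    ultimately show ?thesis using v nth_mem by metis
  qed
  have "(y * h) *\<^sub>v w = (h * x) *\<^sub>v w" if "w \<in> set ?vs" for w
  proof -
    obtain u p k t where w: "(u, p, k) \<in> set ds" "t < k * degree p" "w = x ^\<^sub>m t *\<^sub>v u"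
      using \<open>w \<in> set ?vs\<close> unfolding X.set_cyc_vectors by blast
    obtain v where v: "(v, p, k) \<in> set ds'"
      and match: "\<And>t. t < k * degree p \<Longrightarrow> y ^\<^sub>m t *\<^sub>v v = h *\<^sub>v (x ^\<^sub>m t *\<^sub>v u)"
      using ex[OF w(1)] by blast
    have uv: "u \<in> carrier_vec m" "v \<in> carrier_vec m" using carr w(1) v by force+
    have kill: "monic_irred p" "poly_act x (p ^ k) u = 0\<^sub>v m" "poly_act y (p ^ k) v = 0\<^sub>v m"
      using ds ds' w(1) v by (auto simp: cyclic_decomp_def)
    have all: "y ^\<^sub>m s *\<^sub>v v = h *\<^sub>v (x ^\<^sub>m s *\<^sub>v u)" if "s \<le> k * degree p" for s
      using that match match_top[OF x y h uv kill match] by (cases "s = k * degree p") auto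
    have wc: "w \<in> carrier_vec m" using vs(1) \<open>w \<in> set ?vs\<close> by blast
    have step: "z *\<^sub>v (z ^\<^sub>m s *\<^sub>v v') = z ^\<^sub>m Suc s *\<^sub>v v'" if z: "mat_action m z" and v': "v' \<in> carrier_vec m"
      for z :: "'a mat" and v' s
    proof -
      interpret Z: mat_action m z by (rule z)
      have "emb (z *\<^sub>v (z ^\<^sub>m s *\<^sub>v v')) = emb (z ^\<^sub>m Suc s *\<^sub>v v')"
        using Z.T_power_emb[OF v', of "Suc s"] Z.T_power_emb[OF v', of s]
          Z.T_emb[OF mult_mat_vec_carrier[OF Z.pow_carrier v'], of s] by simp
      then show ?thesis
        using emb_inj[of "z *\<^sub>v (z ^\<^sub>m s *\<^sub>v v')" m "z ^\<^sub>m Suc s *\<^sub>v v'"] Z.x v'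
          mult_mat_vec_carrier[OF Z.pow_carrier v'] by (metis mult_mat_vec_carrier)
    qed
    have "(y * h) *\<^sub>v w = y *\<^sub>v (h *\<^sub>v w)" by (rule assoc_mult_mat_vec[OF y h wc])
    also have "h *\<^sub>v w = y ^\<^sub>m t *\<^sub>v v" using all[of t] w by simp
    also have "y *\<^sub>v (y ^\<^sub>m t *\<^sub>v v) = y ^\<^sub>m Suc t *\<^sub>v v" by (rule step[OF Y.mat_action_axioms uv(2)])
    also have "\<dots> = h *\<^sub>v (x ^\<^sub>m Suc t *\<^sub>v u)" by (rule all) (use w(2) in simp)
    also have "x ^\<^sub>m Suc t *\<^sub>v u = x *\<^sub>v w"
      unfolding w(3) by (rule step[OF X.mat_action_axioms uv(1), symmetric])
    also have "h *\<^sub>v (x *\<^sub>v w) = (h * x) *\<^sub>v w" by (rule assoc_mult_mat_vec[OF h x wc, symmetric])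
    finally show ?thesis .
  qed
  then have "map ((*\<^sub>v) (y * h)) ?vs = map ((*\<^sub>v) (h * x)) ?vs" by simp
  then have "(y * h) * G = (h * x) * G"
    using mat_of_cols_mult[OF mult_carrier_mat[OF y h] vs(1)] mat_of_cols_mult[OF mult_carrier_mat[OF h x] vs(1)]
    unfolding G_def by metis
  then have "y * h = h * x"
    using inv_pair_cancel_right[OF Gi mult_carrier_mat[OF y h]] inv_pair_cancel_right[OF Gi mult_carrier_mat[OF h x]]
    by metis
  moreover have "ds' = map (apfst ((*\<^sub>v) h)) ds"
  proof (rule nth_equalityI)
    show "length ds' = length (map (apfst ((*\<^sub>v) h)) ds)" using la by (simp add: list_all2_lengthD)
    fix i assume "i < length ds'"
    then have i: "i < length ds" "i < length ds'" using la by (auto simp: list_all2_lengthD)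
    obtain u p k where u: "ds ! i = (u, p, k)" by (cases "ds ! i")
    obtain v p' k' where v: "ds' ! i = (v, p', k')" by (cases "ds' ! i")
    have m: "p' = p" "k' = k" "\<forall>t<k * degree p. y ^\<^sub>m t *\<^sub>v v = h *\<^sub>v (x ^\<^sub>m t *\<^sub>v u)"
      using list_all2_nthD[OF la i(1)] u v by auto
    have uin: "(u, p, k) \<in> set ds" and vin: "(v, p, k) \<in> set ds'"
      using i u v m nth_mem[OF i(1)] nth_mem[OF i(2)] by auto
    have uv: "u \<in> carrier_vec m" "v \<in> carrier_vec m" using carr uin vin by force+
    have "monic_irred p" "1 \<le> k" using ds uin by (auto simp: cyclic_decomp_def)
    then have "0 < k * degree p" using monic_irred_degree_pos by force
    then have "v = h *\<^sub>v u" using m(3) uv x y by force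
    then show "ds' ! i = map (apfst ((*\<^sub>v) h)) ds ! i" using i u v m by simp
  qed
  ultimately show ?thesis using that hGL by blast
qed

section \<open>Counting\<close>

text \<open>\<open>GL\<close> acts simply transitively on the pairs of a matrix in the class and a
  decomposition of it with order list \<open>L\<close>: transitively by
  \<open>decomps_same_shape_conjugate\<close>, with trivial stabilizers since a decomposition
  carries a basis. Each matrix of the class has \<open>rcf_denom\<close> such
  decompositions.\<close>

theorem card_rcf_class:
  fixes beta :: "'a::{finite,field} mat"
  assumes beta: "beta \<in> GL m"
  shows "real (card {alpha \<in> GL m. rcf_data m alpha = rcf_data m beta})
    * rcf_denom (real CARD('a)) (rcf_data m beta) = real (card (GL m :: 'a mat set))"
proof -
  let ?C = "{alpha \<in> GL m. rcf_data m alpha = rcf_data m beta}"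
  note b = GL_carrier[OF beta]
  interpret B: mat_action m beta by unfold_locales (fact b)
  obtain ds where ds: "cyclic_decomp m beta ds" "sorted (map snd (map snd ds))"
    using B.sorted_cyclic_decomp_exists .
  define L where "L = map snd ds"
  define D where "D alpha = {ds'. cyclic_decomp m alpha ds' \<and> map snd ds' = L}" for alpha :: "'a mat"
  have rcf: "rcf_data m beta = shape_data L" unfolding L_def by (rule B.rcf_data_eq[OF ds(1)])
  have "\<forall>(p, k)\<in>set L. monic_irred p \<and> p \<noteq> [:0, 1:] \<and> 1 \<le> k"
    using B.cyclic_decomp_entries[OF ds(1)] B.det_nonzero_imp_no_z[OF ds(1)] beta
    by (auto simp: L_def GL_def)
  then have N: "family_count (\<lambda>p k. CARD('a) ^ (degree p * minsum p k L)) L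
      = rcf_denom (real CARD('a)) (rcf_data m beta)"
    unfolding rcf using ds(2) by (intro family_count_rcf_denom) (simp_all add: L_def)
  have D: "finite (D alpha)" "real (card (D alpha)) = rcf_denom (real CARD('a)) (rcf_data m beta)"
    if alpha: "alpha \<in> ?C" for alpha
  proof -
    interpret A: mat_action m alpha by unfold_locales (use alpha in \<open>simp add: GL_def\<close>)
    obtain ds0 where ds0: "cyclic_decomp m alpha ds0" using A.cyclic_decomp_exists by blast
    have eq: "shape_data (map snd ds0) = shape_data L"
      using A.rcf_data_eq[OF ds0] alpha rcf by simp
    have "mset (map snd ds0) = mset L"
    proof (rule multiset_eqI)
      fix d :: "'a poly \<times> nat"
      show "count (mset (map snd ds0)) d = count (mset L) d"
        using count_shape_data[of "map snd ds0" "fst d" "snd d"] count_shape_data[of L "fst d" "snd d"] eq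
        by simp
    qed
    from A.card_cyclic_decomps[OF ds0 this] ds(2) N
    show "finite (D alpha)" "real (card (D alpha)) = rcf_denom (real CARD('a)) (rcf_data m beta)"
      by (simp_all add: D_def L_def)
  qed
  have "\<forall>h\<in>GL m. \<exists>g. inv_pair m (h :: 'a mat) g" using GL_inv_pair by blast
  from bchoice[OF this] obtain I where I: "\<And>h :: 'a mat. h \<in> GL m \<Longrightarrow> inv_pair m h (I h)" by blast
  define F where "F h = (h * beta * I h, map (apfst ((*\<^sub>v) h)) ds)" for h
  have inter: "intertwining m beta (h * beta * I h) h" if h: "h \<in> GL m" for h
  proof -
    have "h * beta * I h \<in> carrier_mat m m"
      using I[OF h] b by (intro mult_carrier_mat[of _ m m]) (auto simp: inv_pair_def)
    then show ?thesis
      using b GL_carrier[OF h] conj_intertwines[OF I[OF h] b] by unfold_locales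
  qed
  have "bij_betw F (GL m) (SIGMA alpha:?C. D alpha)"
    unfolding bij_betw_def
  proof (intro conjI subset_antisym subsetI inj_onI)
    fix h h' assume h: "h \<in> GL m" "h' \<in> GL m" and eq: "F h = F h'"
    let ?vs = "cyc_vectors beta ds"
    let ?G = "mat_of_cols m ?vs"
    note carr = B.cyclic_decomp_carrier[OF ds(1)]
    note vs = B.cyc_vectors_carrier[OF carr]
    \<comment> \<open>Both components of \<open>F\<close> enter: equal conjugates and equal images
      of the generators give equal images of the whole cyclic basis.\<close>
    have "map ((*\<^sub>v) h) ?vs = map ((*\<^sub>v) h') ?vs"
      using intertwining.cyc_vectors_map[OF inter[OF h(1)] carr]
        intertwining.cyc_vectors_map[OF inter[OF h(2)] carr] eq
      unfolding F_def by (metis prod.inject)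
    then have hG: "h * ?G = h' * ?G"
      using mat_of_cols_mult[OF GL_carrier[OF h(1)] vs] mat_of_cols_mult[OF GL_carrier[OF h(2)] vs] by metis
    have "?G \<in> GL m"
      using ds(1) mat_of_cols_carrier(1)[of m ?vs] by (simp add: GL_def cyclic_decomp_def)
    then obtain Gi where Gi: "inv_pair m ?G Gi" using GL_inv_pair by blast
    show "h = h'"
      using inv_pair_cancel_right[OF Gi GL_carrier[OF h(1)]] inv_pair_cancel_right[OF Gi GL_carrier[OF h(2)]] hG
      by metis
  next
    fix z assume "z \<in> F ` GL m"
    then obtain h where h: "h \<in> GL m" and z: "z = F h" by blast
    have "h * beta * I h \<in> ?C"
      using GL_mult[OF GL_mult[OF h beta] inv_pair_GL[OF inv_pair_sym[OF I[OF h]]]]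
        rcf_data_conj[OF I[OF h] b] by simp
    moreover have "map (apfst ((*\<^sub>v) h)) ds \<in> D (h * beta * I h)"
      using intertwining.cyclic_decomp_map[OF inter[OF h] ds(1)] h
      by (simp add: D_def L_def GL_def del: map_map)
    ultimately show "z \<in> (SIGMA alpha:?C. D alpha)" by (simp add: z F_def)
  next
    fix z assume "z \<in> (SIGMA alpha:?C. D alpha)"
    then obtain alpha ds' where z: "z = (alpha, ds')" "alpha \<in> ?C" "ds' \<in> D alpha" by blast
    have a: "alpha \<in> carrier_mat m m" using z(2) GL_carrier by blast
    obtain h where h: "h \<in> GL m" "alpha * h = h * beta" "ds' = map (apfst ((*\<^sub>v) h)) ds"
      using decomps_same_shape_conjugate[OF b a ds(1), of ds'] z(3) by (auto simp: D_def L_def)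
    have "F h = z" unfolding F_def z(1) using intertwine_conj[OF I[OF h(1)] b a h(2)] h(3) by simp
    then show "z \<in> F ` GL m" using h(1) by blast
  qed
  then have "card (GL m :: 'a mat set) = card (SIGMA alpha:?C. D alpha)" by (rule bij_betw_same_card)
  also have "\<dots> = (\<Sum>alpha\<in>?C. card (D alpha))"
    using finite_GL[where 'a='a, of m] D(1) by (intro card_SigmaI) auto
  finally show ?thesis using D(2) by simp
qed

text \<open>The witness is a rank-one change of the identity, \<open>1 + (v - e) w^T\<close> with
  \<open>w \<bullet> e = 1\<close>, which sends \<open>e\<close> to \<open>v\<close>. Its
  determinant would be \<open>w \<bullet> v\<close> by the matrix determinant lemma; here
  invertibility is checked on the kernel.\<close>

lemma GL_transitive:
  fixes v :: "'a::field vec"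
  assumes v: "v \<in> carrier_vec m" "v \<noteq> 0\<^sub>v m" and m: "0 < m"
  obtains h where "h \<in> GL m" "h *\<^sub>v unit_vec m 0 = v"
proof -
  let ?e = "unit_vec m 0 :: 'a vec"
  obtain i where i: "i < m" "v $ i \<noteq> 0" using v by (auto simp: vec_eq_iff)
  \<comment> \<open>\<open>w\<close> is \<open>e_0\<close> if \<open>v $ 0 \<noteq> 0\<close>, and
    otherwise \<open>e_0 + e_i\<close> for a nonzero coordinate \<open>i\<close> of
    \<open>v\<close>; both give \<open>w \<bullet> e = 1\<close> and
    \<open>w \<bullet> v \<noteq> 0\<close>.\<close>
  define w where "w = vec m (\<lambda>j. if j = 0 \<or> v $ 0 = 0 \<and> j = i then 1 else 0 :: 'a)"
  define h where "h = mat m m (\<lambda>(i, j). (if i = j then 1 else 0) + (v - ?e) $ i * w $ j)"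
  have w: "w \<in> carrier_vec m" by (simp add: w_def)
  have h: "h \<in> carrier_mat m m" by (simp add: h_def)
  have wsum: "w \<bullet> c = c $ 0 + (if v $ 0 = 0 \<and> i \<noteq> 0 then c $ i else 0)" if "c \<in> carrier_vec m" for c
  proof -
    have "w \<bullet> c = (\<Sum>j<m. (if j = 0 then c $ j else 0) + (if j = i then if v $ 0 = 0 \<and> i \<noteq> 0 then c $ j else 0 else 0))"
      using that by (auto simp: scalar_prod_def w_def lessThan_atLeast0 intro!: sum.cong)
    then show ?thesis using i(1) m by (simp add: sum.distrib)
  qed
  have hc: "(h *\<^sub>v c) $ r = c $ r + (v - ?e) $ r * (w \<bullet> c)" if c: "c \<in> carrier_vec m" "r < m" for c r
  proof -
    have "(h *\<^sub>v c) $ r = (\<Sum>j<m. ((if r = j then 1 else 0) + (v - ?e) $ r * w $ j) * c $ j)"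
      using c by (auto simp: h_def scalar_prod_def lessThan_atLeast0 intro!: sum.cong)
    also have "\<dots> = (\<Sum>j<m. (if r = j then c $ j else 0) + (v - ?e) $ r * (w $ j * c $ j))"
      by (rule sum.cong) (auto simp: algebra_simps)
    also have "\<dots> = (\<Sum>j<m. if r = j then c $ j else 0) + (v - ?e) $ r * (\<Sum>j<m. w $ j * c $ j)"
      by (simp only: sum.distrib sum_distrib_left)
    also have "(\<Sum>j<m. w $ j * c $ j) = w \<bullet> c"
      using c by (simp add: scalar_prod_def lessThan_atLeast0)
    finally show ?thesis using c(2) by simp
  qed
  have we: "w \<bullet> ?e = 1" using wsum[of ?e] i m by simp
  have wv: "w \<bullet> v \<noteq> 0" using wsum[OF v(1)] i by auto
  have "h *\<^sub>v ?e = v"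
  proof (rule eq_vecI)
    fix r assume "r < dim_vec v"
    then have r: "r < m" using v(1) by simp
    have "(h *\<^sub>v ?e) $ r = ?e $ r + (v - ?e) $ r * 1" unfolding hc[OF unit_vec_carrier r] we ..
    also have "\<dots> = v $ r" using r v(1) by simp
    finally show "(h *\<^sub>v ?e) $ r = v $ r" .
  qed (use v(1) h in auto)
  moreover have "det h \<noteq> 0"
  proof
    assume "det h = 0"
    then obtain c where c: "c \<in> carrier_vec m" "c \<noteq> 0\<^sub>v m" "h *\<^sub>v c = 0\<^sub>v m"
      using det_0_iff_vec_prod_zero_field[OF h] by blast
    have cr: "c $ r = - ((v $ r - ?e $ r) * (w \<bullet> c))" if "r < m" for r
      using hc[OF c(1) that] c(3) that v(1) by (simp add: eq_neg_iff_add_eq_0)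
    \<comment> \<open>A kernel vector is \<open>c = - (w \<bullet> c) (v - e)\<close>; pairing with
      \<open>w\<close> gives \<open>(w \<bullet> v) (w \<bullet> c) = 0\<close>, hence
      \<open>c = 0\<close>.\<close>
    have "w \<bullet> c = - ((w \<bullet> v - w \<bullet> ?e) * (w \<bullet> c))"
    proof (cases "v $ 0 = 0 \<and> i \<noteq> 0")
      case True
      have ws: "w \<bullet> d = d $ 0 + d $ i" if "d \<in> carrier_vec m" for d
        unfolding wsum[OF that] by (simp only: True if_True simp_thms)
      have "w \<bullet> c = c $ 0 + c $ i" by (rule ws[OF c(1)])
      also have "\<dots> = - ((v $ 0 - ?e $ 0) * (w \<bullet> c)) + - ((v $ i - ?e $ i) * (w \<bullet> c))"
        by (simp only: cr[OF m, symmetric] cr[OF i(1), symmetric])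
      also have "\<dots> = - (((v $ 0 + v $ i) - (?e $ 0 + ?e $ i)) * (w \<bullet> c))"
        by (simp add: algebra_simps)
      also have "\<dots> = - ((w \<bullet> v - w \<bullet> ?e) * (w \<bullet> c))"
        by (simp only: ws[OF v(1)] ws[OF unit_vec_carrier])
      finally show ?thesis .
    next
      case False
      have ws: "w \<bullet> d = d $ 0" if "d \<in> carrier_vec m" for d
        unfolding wsum[OF that] by (simp only: False if_False add_0_right)
      have "w \<bullet> c = c $ 0" by (rule ws[OF c(1)])
      also have "\<dots> = - ((v $ 0 - ?e $ 0) * (w \<bullet> c))" by (rule cr[OF m])
      also have "\<dots> = - ((w \<bullet> v - w \<bullet> ?e) * (w \<bullet> c))"
        by (simp only: ws[OF v(1)] ws[OF unit_vec_carrier])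
      finally show ?thesis .
    qed
    then have "(w \<bullet> v) * (w \<bullet> c) = 0" by (simp add: we algebra_simps)
    then have "w \<bullet> c = 0" using wv by simp
    then have "c = 0\<^sub>v m" using cr c(1) by (auto simp: vec_eq_iff)
    then show False using c(2) by simp
  qed
  ultimately show ?thesis using that h by (auto simp: GL_def)
qed

section \<open>Double counting over vectors\<close>

lemma double_count:
  assumes "finite A" "finite B"
  shows "(\<Sum>a\<in>A. card {b \<in> B. R a b}) = (\<Sum>b\<in>B. card {a \<in> A. R a b})"
proof -
  have "card {b \<in> B. R a b} = (\<Sum>b\<in>B. if R a b then 1 else 0)" for a
    using assms(2) by (simp add: sum.If_cases Int_def)
  moreover have "card {a \<in> A. R a b} = (\<Sum>a\<in>A. if R a b then 1 else 0)" for b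
    using assms(1) by (simp add: sum.If_cases Int_def)
  ultimately show ?thesis using sum.swap by simp
qed

lemma finite_GL_Collect: "finite {x \<in> (GL m :: 'a::{finite,field} mat set). Q x}"
  by (rule finite_subset[OF _ finite_GL[of m]]) blast

text \<open>Left multiplication by \<open>h\<close> moves the first column from \<open>w\<close> to
  \<open>h w\<close>. Used for \<open>h\<close> and for its inverse it yields equality.\<close>

lemma card_GL_first_column_le:
  fixes h :: "'a::{finite,field} mat"
  assumes hg: "inv_pair m h g" and w: "w \<in> carrier_vec m"
  shows "card {x \<in> GL m. x *\<^sub>v unit_vec m 0 = w} \<le> card {x \<in> GL m. x *\<^sub>v unit_vec m 0 = h *\<^sub>v w}"
proof (rule card_inj_on_le[where f = "(*) h"])
  show "inj_on ((*) h) {x \<in> GL m. x *\<^sub>v unit_vec m 0 = w}"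
  proof (rule inj_onI)
    fix x y assume xy: "x \<in> {x \<in> GL m. x *\<^sub>v unit_vec m 0 = w}" "y \<in> {x \<in> GL m. x *\<^sub>v unit_vec m 0 = w}"
      and eq: "h * x = h * y"
    have "x = g * (h * x)" using xy(1) by (intro inv_pair_cancel_left[OF hg, symmetric] GL_carrier) blast
    also have "\<dots> = y" unfolding eq using xy(2) by (intro inv_pair_cancel_left[OF hg] GL_carrier) blast
    finally show "x = y" .
  qed
  show "(*) h ` {x \<in> GL m. x *\<^sub>v unit_vec m 0 = w} \<subseteq> {x \<in> GL m. x *\<^sub>v unit_vec m 0 = h *\<^sub>v w}"
  proof clarify
    fix x :: "'a mat" assume x: "x \<in> GL m"
    have "h * x *\<^sub>v unit_vec m 0 = h *\<^sub>v (x *\<^sub>v unit_vec m 0)"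
      using hg GL_carrier[OF x] by (intro assoc_mult_mat_vec[of _ m m _ m]) (auto simp: inv_pair_def)
    then show "h * x \<in> GL m \<and> h * x *\<^sub>v unit_vec m 0 = h *\<^sub>v (x *\<^sub>v unit_vec m 0)"
      using GL_mult[OF inv_pair_GL[OF hg] x] by simp
  qed
  show "finite {x \<in> GL m. x *\<^sub>v unit_vec m 0 = h *\<^sub>v w}" by (rule finite_GL_Collect)
qed

lemma card_GL_first_column:
  fixes w :: "'a::{finite,field} vec"
  assumes w: "w \<in> carrier_vec m" "w \<noteq> 0\<^sub>v m" and m: "0 < m"
  shows "card {x \<in> GL m. x *\<^sub>v unit_vec m 0 = w} = card {x \<in> GL m. x *\<^sub>v unit_vec m 0 = (unit_vec m 0 :: 'a vec)}"
proof -
  obtain h where h: "h \<in> GL m" "h *\<^sub>v unit_vec m 0 = w" using GL_transitive[OF w m] .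
  obtain g where g: "inv_pair m h g" using GL_inv_pair[OF h(1)] .
  have "g *\<^sub>v w = unit_vec m 0" using inv_pair_vec[OF g, of "unit_vec m 0"] h(2) by simp
  then show ?thesis
    using card_GL_first_column_le[OF g, of "unit_vec m 0"] card_GL_first_column_le[OF inv_pair_sym[OF g] w(1)] h(2)
    by simp
qed

lemma card_nonzero_vec:
  "card (carrier_vec m - {0\<^sub>v m :: 'a::{finite,field} vec}) = CARD('a) ^ m - 1"
  using finite_carrier_vec[where 'a='a, of m] by (simp add: card_carrier_vec)

text \<open>Each invertible matrix has one first column, a nonzero vector, and by transitivity all
  \<open>q ^ m - 1\<close> nonzero vectors occur equally often.\<close>

lemma card_GL:
  assumes m: "0 < m"
  shows "card (GL m :: 'a::{finite,field} mat set) =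
    (CARD('a) ^ m - 1) * card {x \<in> GL m. x *\<^sub>v unit_vec m 0 = (unit_vec m 0 :: 'a vec)}"
proof -
  let ?e = "unit_vec m 0 :: 'a vec"
  let ?N = "carrier_vec m - {0\<^sub>v m :: 'a vec}"
  have "(\<Sum>w\<in>?N. card {x \<in> GL m. x *\<^sub>v ?e = w}) = (\<Sum>x\<in>GL m. card {w \<in> ?N. x *\<^sub>v ?e = w})"
    using finite_carrier_vec finite_GL by (intro double_count) auto
  also have "\<dots> = (\<Sum>x\<in>(GL m :: 'a mat set). 1)"
  proof (rule sum.cong[OF refl])
    fix x :: "'a mat" assume x: "x \<in> GL m"
    note xc = GL_carrier[OF x]
    have "x *\<^sub>v ?e \<noteq> 0\<^sub>v m"
    proof
      assume "x *\<^sub>v ?e = 0\<^sub>v m"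
      moreover have "?e \<in> carrier_vec m" "?e \<noteq> 0\<^sub>v m" using m by simp_all
      ultimately have "det x = 0" using det_0_iff_vec_prod_zero_field[OF xc] by metis
      then show False using x by (simp add: GL_def)
    qed
    moreover have "x *\<^sub>v ?e \<in> carrier_vec m" using xc by (rule mult_mat_vec_carrier) simp
    ultimately have "{w \<in> ?N. x *\<^sub>v ?e = w} = {x *\<^sub>v ?e}" by auto
    then show "card {w \<in> ?N. x *\<^sub>v ?e = w} = 1" by simp
  qed
  finally have "card (GL m :: 'a mat set) = (\<Sum>w\<in>?N. card {x \<in> GL m. x *\<^sub>v ?e = w})" by simp
  also have "\<dots> = (\<Sum>w\<in>?N. card {x \<in> GL m. x *\<^sub>v ?e = ?e})"
    by (rule sum.cong[OF refl], rule card_GL_first_column[OF _ _ m]) auto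
  finally show ?thesis by (simp add: card_nonzero_vec)
qed

text \<open>Conjugation by \<open>h\<close> preserves the data and the eigenvalue and moves the
  eigenvector \<open>u\<close> to \<open>h u\<close>; the inverse gives the other inequality in
  \<open>card_class_eigenvector\<close>.\<close>

lemma card_class_eigenvector_le:
  fixes h :: "'a::{finite,field} mat"
  assumes hg: "inv_pair m h g" and u: "u \<in> carrier_vec m"
  shows "card {x \<in> GL m. rcf_data m x = lam \<and> x *\<^sub>v u = a \<cdot>\<^sub>v u}
    \<le> card {x \<in> GL m. rcf_data m x = lam \<and> x *\<^sub>v (h *\<^sub>v u) = a \<cdot>\<^sub>v (h *\<^sub>v u)}"
    (is "card ?A \<le> card ?B")
proof (rule card_inj_on_le[where f = "\<lambda>x. h * x * g"])
  have hgc: "h \<in> carrier_mat m m" "g \<in> carrier_mat m m" using hg by (auto simp: inv_pair_def)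
  show "inj_on (\<lambda>x. h * x * g) ?A"
  proof (rule inj_onI)
    fix x y assume xy: "x \<in> ?A" "y \<in> ?A" "h * x * g = h * y * g"
    then have c: "x \<in> carrier_mat m m" "y \<in> carrier_mat m m" using GL_carrier by auto
    have "h * x = h * y" using conj_intertwines[OF hg c(1)] conj_intertwines[OF hg c(2)] xy(3) by metis
    then show "x = y" using inv_pair_cancel_left[OF hg c(1)] inv_pair_cancel_left[OF hg c(2)] by metis
  qed
  have "h * x * g \<in> ?B" if xA: "x \<in> ?A" for x
  proof -
    have xG: "x \<in> GL m" and xu: "x *\<^sub>v u = a \<cdot>\<^sub>v u" using xA by auto
    note x = GL_carrier[OF xG]
    have hx: "h * x \<in> carrier_mat m m" by (rule mult_carrier_mat[OF hgc(1) x])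
    have hu: "h *\<^sub>v u \<in> carrier_vec m" by (rule mult_mat_vec_carrier[OF hgc(1) u])
    have "(h * x * g) *\<^sub>v (h *\<^sub>v u) = (h * x) *\<^sub>v (g *\<^sub>v (h *\<^sub>v u))"
      by (rule assoc_mult_mat_vec[OF hx hgc(2) hu])
    also have "\<dots> = h *\<^sub>v (x *\<^sub>v u)"
      unfolding inv_pair_vec[OF hg u] by (rule assoc_mult_mat_vec[OF hgc(1) x u])
    also have "\<dots> = a \<cdot>\<^sub>v (h *\<^sub>v u)" unfolding xu by (rule mult_mat_vec[OF hgc(1) u])
    finally show ?thesis
      using xA rcf_data_conj[OF hg x] GL_mult[OF GL_mult[OF inv_pair_GL[OF hg] xG] inv_pair_GL[OF inv_pair_sym[OF hg]]]
      by simp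
  qed
  then show "(\<lambda>x. h * x * g) ` ?A \<subseteq> ?B" by blast
  show "finite ?B" by (rule finite_GL_Collect)
qed

lemma card_class_eigenvector:
  fixes u :: "'a::{finite,field} vec"
  assumes u: "u \<in> carrier_vec m" "u \<noteq> 0\<^sub>v m" and m: "0 < m"
  shows "card {x \<in> GL m. rcf_data m x = lam \<and> x *\<^sub>v u = a \<cdot>\<^sub>v u}
    = card {x \<in> GL m. rcf_data m x = lam \<and> x *\<^sub>v unit_vec m 0 = a \<cdot>\<^sub>v unit_vec m 0}"
proof -
  obtain h where h: "h \<in> GL m" "h *\<^sub>v unit_vec m 0 = u" using GL_transitive[OF u m] .
  obtain g where g: "inv_pair m h g" using GL_inv_pair[OF h(1)] .
  have "g *\<^sub>v u = unit_vec m 0" using inv_pair_vec[OF g, of "unit_vec m 0"] h(2) by simp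
  then show ?thesis
    using card_class_eigenvector_le[OF g, of "unit_vec m 0" lam a]
      card_class_eigenvector_le[OF inv_pair_sym[OF g] u(1), of lam a] h(2)
    by simp
qed

text \<open>For pairs of a matrix in the class and a nonzero eigenvector for \<open>a\<close>, both
  kinds of fibre have constant size: over a vector by transitivity and conjugation, over a matrix
  because the data fix the size of the eigenspace, from which 0 is removed.\<close>

lemma card_class_times_eigenvectors:
  fixes lam :: "'a::{finite,field} poly \<Rightarrow> nat multiset"
  assumes m: "0 < m"
  shows "(CARD('a) ^ m - 1) * card {x \<in> GL m. rcf_data m x = lam \<and> x *\<^sub>v unit_vec m 0 = a \<cdot>\<^sub>v unit_vec m 0}
    = card {x \<in> GL m. rcf_data m x = lam} * (CARD('a) ^ part_conj (lam [:- a, 1:]) 1 - 1)"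
proof -
  let ?C = "{x \<in> GL m. rcf_data m x = lam}"
  let ?N = "carrier_vec m - {0\<^sub>v m :: 'a vec}"
  have "(\<Sum>u\<in>?N. card {x \<in> ?C. x *\<^sub>v u = a \<cdot>\<^sub>v u}) = (\<Sum>x\<in>?C. card {u \<in> ?N. x *\<^sub>v u = a \<cdot>\<^sub>v u})"
    using finite_carrier_vec by (intro double_count finite_GL_Collect) auto
  moreover have "card {x \<in> ?C. x *\<^sub>v u = a \<cdot>\<^sub>v u}
      = card {x \<in> GL m. rcf_data m x = lam \<and> x *\<^sub>v unit_vec m 0 = a \<cdot>\<^sub>v unit_vec m 0}" if "u \<in> ?N" for u
    using card_class_eigenvector[OF _ _ m, of u lam a] that by (simp add: conj_assoc)
  moreover have "card {u \<in> ?N. x *\<^sub>v u = a \<cdot>\<^sub>v u} = CARD('a) ^ part_conj (lam [:- a, 1:]) 1 - 1" if xC: "x \<in> ?C" for x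
  proof -
    have xc: "x \<in> carrier_mat m m" using xC GL_carrier by blast
    interpret mat_action m x by unfold_locales (fact xc)
    have "{u \<in> ?N. x *\<^sub>v u = a \<cdot>\<^sub>v u} = {u \<in> carrier_vec m. x *\<^sub>v u = a \<cdot>\<^sub>v u} - {0\<^sub>v m}" by blast
    moreover have "0\<^sub>v m \<in> {u \<in> carrier_vec m. x *\<^sub>v u = a \<cdot>\<^sub>v u}" using xc by auto
    ultimately show ?thesis
      using card_eigenspace[of a] finite_carrier_vec[where 'a='a, of m] xC by simp
  qed
  ultimately show ?thesis by (simp add: card_nonzero_vec)
qed

lemma first_column_iff:
  fixes x :: "'a::field mat"
  assumes x: "x \<in> carrier_mat (n + 1) (n + 1)"
  shows "x *\<^sub>v unit_vec (n + 1) 0 = a \<cdot>\<^sub>v unit_vec (n + 1) 0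
    \<longleftrightarrow> x $$ (0, 0) = a \<and> (\<forall>j\<in>{1..n}. x $$ (j, 0) = 0)"
proof -
  have "(x *\<^sub>v unit_vec (n + 1) 0) $ i = x $$ (i, 0)" if "i < n + 1" for i
    using x that by (simp add: scalar_prod_right_unit)
  then have "x *\<^sub>v unit_vec (n + 1) 0 = a \<cdot>\<^sub>v unit_vec (n + 1) 0
      \<longleftrightarrow> (\<forall>i<n + 1. x $$ (i, 0) = (if i = 0 then a else 0))"
    using x by (auto simp: vec_eq_iff)
  also have "\<dots> \<longleftrightarrow> x $$ (0, 0) = a \<and> (\<forall>j\<in>{1..n}. x $$ (j, 0) = 0)"
    by (auto simp: less_Suc_eq_le Suc_le_eq)
  finally show ?thesis .
qed

theorem theorem2p3:
  fixes n :: nat and beta :: "'a::{finite,field} mat"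
  assumes "beta \<in> GL (n+1)"
  defines "q \<equiv> real (card (UNIV :: 'a set))"
  defines "lam \<equiv> rcf_data (n+1) beta"
  shows
    "(real (card {alpha \<in> (A_grp n :: 'a mat set). rcf_data (n+1) alpha = lam}) =
       real (card (A_grp n :: 'a mat set)) * (q ^ part_conj (lam [:-1,1:]) 1 - 1) / rcf_denom q lam) \<and>
     (real (card {alpha \<in> (P_grp n :: 'a mat set). rcf_data (n+1) alpha = lam}) =
       (\<Sum>a\<in>{a::'a. a \<noteq> 0}. real (card (P_grp n :: 'a mat set)) * (q ^ part_conj (lam [:-a,1:]) 1 - 1)
          / (q - 1) * (1 / rcf_denom q lam)))"
proof -
  let ?m = "n + 1"
  let ?e = "unit_vec ?m 0 :: 'a vec"
  \<comment> \<open>\<open>W a\<close> consists of the invertible matrices with first column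
    \<open>a e_0\<close>: \<open>A_grp n\<close> is \<open>W 1\<close>, and \<open>P_grp n\<close>
    is the disjoint union over nonzero \<open>a\<close>.\<close>
  define W where "W a = {x \<in> (GL ?m :: 'a mat set). x *\<^sub>v ?e = a \<cdot>\<^sub>v ?e}" for a
  define C where "C = {x \<in> (GL ?m :: 'a mat set). rcf_data ?m x = lam}"
  have W: "W a = {x \<in> GL ?m. x $$ (0, 0) = a \<and> (\<forall>j\<in>{1..n}. x $$ (j, 0) = 0)}" for a
    unfolding W_def using first_column_iff GL_carrier by blast
  have A: "A_grp n = W 1" unfolding W A_grp_def ..
  have P: "P_grp n = (\<Union>a\<in>{a. a \<noteq> 0}. W a)" unfolding W P_grp_def by auto
  have disj: "W a \<inter> W b = {}" if "a \<noteq> b" for a b unfolding W using that by auto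
  have finW: "finite (W a)" for a unfolding W_def by (rule finite_GL_Collect)
  have q2: "2 \<le> q" unfolding q_def using card_mono[of "UNIV :: 'a set" "{0, 1}"] by simp
  have qm: "1 < q ^ ?m" using q2 by (intro one_less_power) auto
  have W1: "W 1 = {x \<in> GL ?m. x *\<^sub>v ?e = ?e}" unfolding W_def by simp
  have cardW: "card (W a) = card (W 1)" if "a \<noteq> 0" for a
  proof -
    have "(a \<cdot>\<^sub>v ?e) $ 0 = a" "(0\<^sub>v ?m :: 'a vec) $ 0 = 0" by simp_all
    then have "a \<cdot>\<^sub>v ?e \<noteq> 0\<^sub>v ?m" using that by metis
    then show ?thesis unfolding W1 unfolding W_def by (intro card_GL_first_column) auto
  qed
  have real_pow: "real (CARD('a) ^ k - 1) = q ^ k - 1" for k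
    using q2 by (simp add: q_def of_nat_diff)
  \<comment> \<open>The factor \<open>q ^ ?m - 1\<close> is the number of nonzero vectors and
    cancels below against the same factor from counting eigenvectors.\<close>
  have GLcard: "real (card (GL ?m :: 'a mat set)) = (q ^ ?m - 1) * real (card (W 1))"
    unfolding W1 real_pow[symmetric] by (subst card_GL) (auto simp: of_nat_mult)
  have class_card: "real (card C) * rcf_denom q lam = real (card (GL ?m :: 'a mat set))"
    unfolding C_def lam_def q_def by (rule card_rcf_class[OF assms(1)])
  have "1\<^sub>m ?m \<in> (GL ?m :: 'a mat set)" by (simp add: GL_def)
  then have "card (GL ?m :: 'a mat set) \<noteq> 0" using finite_GL[where 'a='a, of ?m] by auto
  \<comment> \<open>Nonvanishing is read off the class equation rather than off the product
    formula.\<close>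
  then have N0: "rcf_denom q lam \<noteq> 0" using class_card by auto
  have eig: "real (card {x \<in> W a. rcf_data ?m x = lam})
      = real (card (W 1)) * (q ^ part_conj (lam [:- a, 1:]) 1 - 1) / rcf_denom q lam" for a
  proof -
    have set_eq: "{x \<in> W a. rcf_data ?m x = lam} = {x \<in> GL ?m. rcf_data ?m x = lam \<and> x *\<^sub>v ?e = a \<cdot>\<^sub>v ?e}"
      unfolding W_def by blast
    have "real ((CARD('a) ^ ?m - 1) * card {x \<in> W a. rcf_data ?m x = lam})
        = real (card C * (CARD('a) ^ part_conj (lam [:- a, 1:]) 1 - 1))"
      unfolding set_eq C_def using card_class_times_eigenvectors[of ?m lam a] by simp
    then have "(q ^ ?m - 1) * real (card {x \<in> W a. rcf_data ?m x = lam})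
        = real (card C) * (q ^ part_conj (lam [:- a, 1:]) 1 - 1)"
      unfolding of_nat_mult real_pow .
    then have "(q ^ ?m - 1) * (real (card {x \<in> W a. rcf_data ?m x = lam}) * rcf_denom q lam)
        = (real (card C) * rcf_denom q lam) * (q ^ part_conj (lam [:- a, 1:]) 1 - 1)"
      by (simp add: mult.commute mult.left_commute)
    also have "\<dots> = (q ^ ?m - 1) * (real (card (W 1)) * (q ^ part_conj (lam [:- a, 1:]) 1 - 1))"
      unfolding class_card GLcard by simp
    finally have *: "(q ^ ?m - 1) * (real (card {x \<in> W a. rcf_data ?m x = lam}) * rcf_denom q lam) = \<dots>" .
    have "q ^ ?m - 1 \<noteq> 0" using qm by simp
    from mult_left_cancel[OF this, THEN iffD1, OF *]
    show ?thesis by (simp only: nonzero_eq_divide_eq[OF N0])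
  qed
  have "card (P_grp n :: 'a mat set) = (\<Sum>a\<in>{a::'a. a \<noteq> 0}. card (W a))"
    unfolding P using finW disj by (intro card_UN_disjoint) auto
  also have "\<dots> = (\<Sum>a\<in>{a::'a. a \<noteq> 0}. card (W 1))"
    by (rule sum.cong[OF refl], rule cardW) simp
  also have "\<dots> = (CARD('a) - 1) * card (W 1)"
  proof -
    have "{a::'a. a \<noteq> 0} = UNIV - {0}" by auto
    then have "card {a::'a. a \<noteq> 0} = CARD('a) - 1" by (simp add: card_Diff_singleton)
    then show ?thesis by simp
  qed
  finally have Pcard: "real (card (P_grp n :: 'a mat set)) = (q - 1) * real (card (W 1))"
    using real_pow[of 1] by simp
  have "{alpha \<in> (P_grp n :: 'a mat set). rcf_data ?m alpha = lam}
      = (\<Union>a\<in>{a. a \<noteq> 0}. {x \<in> W a. rcf_data ?m x = lam})" unfolding P by blast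
  moreover have "card \<dots> = (\<Sum>a\<in>{a::'a. a \<noteq> 0}. card {x \<in> W a. rcf_data ?m x = lam})"
    using finW disj by (intro card_UN_disjoint) auto
  ultimately have "real (card {alpha \<in> (P_grp n :: 'a mat set). rcf_data ?m alpha = lam})
      = (\<Sum>a\<in>{a::'a. a \<noteq> 0}. real (card {x \<in> W a. rcf_data ?m x = lam}))" by simp
  \<comment> \<open>\<open>P_grp n\<close> is \<open>q - 1\<close> times as large as
    \<open>W 1\<close>, which accounts for the denominator \<open>q - 1\<close>.\<close>
  also have "\<dots> = (\<Sum>a\<in>{a::'a. a \<noteq> 0}. real (card (P_grp n :: 'a mat set)) * (q ^ part_conj (lam [:-a,1:]) 1 - 1)
          / (q - 1) * (1 / rcf_denom q lam))"
    unfolding eig Pcard using q2 by simp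
  finally show ?thesis using eig[of 1] unfolding A by simp
qed

end
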